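(* Let $G$ be a connected graph of order $n\geq 9$. Then $m(-1)=n-4$ if and only if $G\in\{K_{n-3}\vee(K_2\cup K_1),\ K_{n-3}\vee 3K_1\}$. In addition, each such $G$ is determined by its $\mathcal{A}$-spectrum.
   Context: $K_m$ is the complete graph on $m$ vertices, $3K_1$ three isolated vertices, $\cup$ disjoint union, $\vee$ join. For a connected graph $G$, $d(u,v)$ is the distance and $\varepsilon(v)=\max_u d(u,v)$ the eccentricity. The eccentricity matrix $\mathcal{A}(G)$ is indexed by $V(G)$ with $(u,v)$-entry $d(u,v)$ if $d(u,v)=\min\{\varepsilon(u),\varepsilon(v)\}$ and $0$ otherwise; its $\mathcal{A}$-spectrum is the multiset of its eigenvalues. $m(-1)$ is the multiplicity of $-1$ in the $\mathcal{A}$-spectrum. A graph $G$ is determined by its $\mathcal{A}$-spectrum if every connected graph with the same $\mathcal{A}$-spectrum is isomorphic to $G$. *)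

theory Defs
  imports
    "Graph_Theory.Graph_Theory"
    "Jordan_Normal_Form.Char_Poly"
begin

text \<open>
  A finite simple undirected graph is a \<^locale>\<open>pair_graph\<close>: a loop-free digraph without
  parallel arcs and with a symmetric arc relation, so that an edge is a pair of opposite arcs.
\<close>

definition complete_graph :: "nat \<Rightarrow> nat pair_pre_digraph" where
  "complete_graph m = \<lparr> pverts = {..<m}, parcs = {(u, v). u < m \<and> v < m \<and> u \<noteq> v} \<rparr>"

definition edgeless_graph :: "nat \<Rightarrow> nat pair_pre_digraph" where
  "edgeless_graph m = \<lparr> pverts = {..<m}, parcs = {} \<rparr>"

definition disjoint_union ::
  "'a pair_pre_digraph \<Rightarrow> 'b pair_pre_digraph \<Rightarrow> ('a + 'b) pair_pre_digraph" where
  "disjoint_union G H = \<lparr> pverts = pverts G <+> pverts H,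
     parcs = map_prod Inl Inl ` parcs G \<union> map_prod Inr Inr ` parcs H \<rparr>"

definition graph_join ::
  "'a pair_pre_digraph \<Rightarrow> 'b pair_pre_digraph \<Rightarrow> ('a + 'b) pair_pre_digraph" where
  "graph_join G H = \<lparr> pverts = pverts G <+> pverts H,
     parcs = parcs (disjoint_union G H)
       \<union> Inl ` pverts G \<times> Inr ` pverts H \<union> Inr ` pverts H \<times> Inl ` pverts G \<rparr>"

text \<open>
  Walks are lists of arcs, so the length of the list is the number of edges. The value is
  meaningful only if \<open>v\<close> is reachable from \<open>u\<close>.
\<close>

definition gdist :: "'a pair_pre_digraph \<Rightarrow> 'a \<Rightarrow> 'a \<Rightarrow> nat" where
  "gdist G u v = (LEAST k. \<exists>p. pre_digraph.awalk (with_proj G) u p v \<and> length p = k)"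

definition eccentricity :: "'a pair_pre_digraph \<Rightarrow> 'a \<Rightarrow> nat" where
  "eccentricity G v = Max (gdist G v ` pverts G)"

definition ecc_entry :: "'a pair_pre_digraph \<Rightarrow> 'a \<Rightarrow> 'a \<Rightarrow> nat" where
  "ecc_entry G u v =
     (if gdist G u v = min (eccentricity G u) (eccentricity G v) then gdist G u v else 0)"

text \<open>
  Matrices are indexed by initial segments of the naturals, so the eccentricity matrix is taken
  with respect to an enumeration \<open>vs\<close> of the vertices. Its spectrum does not depend on that
  enumeration (\<open>ecc_spectrum_eq\<close> below). The entries are embedded into the complex numbers so
  that the roots of the characteristic polynomial, with multiplicity, are all the eigenvalues.
\<close>

definition ecc_matrix :: "'a pair_pre_digraph \<Rightarrow> 'a list \<Rightarrow> complex mat" where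
  "ecc_matrix G vs =
     mat (length vs) (length vs) (\<lambda>(i, j). of_nat (ecc_entry G (vs ! i) (vs ! j)))"

definition ecc_spectrum :: "'a pair_pre_digraph \<Rightarrow> complex multiset" where
  "ecc_spectrum G =
     proots (char_poly (ecc_matrix G (SOME vs. distinct vs \<and> set vs = pverts G)))"

text \<open>
  The competing graphs \<open>H\<close> may have any order; their vertices are drawn from the type \<open>'b\<close>
  named by the first argument.
\<close>

definition determined_by_ecc_spectrum :: "'b itself \<Rightarrow> 'a pair_pre_digraph \<Rightarrow> bool" where
  "determined_by_ecc_spectrum _ G \<longleftrightarrow>
     (\<forall>H :: 'b pair_pre_digraph.
        pair_graph H \<and> Digraph_Component.connected (with_proj H) \<and> ecc_spectrum H = ecc_spectrum G
        \<longrightarrow> digraph_iso (with_proj H) (with_proj G))"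

lemma gdist_eq_shortest_path_cost:
  assumes "pair_wf_digraph G" "reachable (with_proj G) u v"
  shows "wf_digraph.\<mu> (with_proj G) (\<lambda>_. 1) u v = ereal (real (gdist G u v))"
proof -
  interpret pair_wf_digraph G by fact
  have cost: "awalk_cost (\<lambda>_. 1) p = real (length p)" for p
    by (induction p) auto
  obtain p0 where p0: "awalk u p0 v"
    using assms(2) by (auto simp: reachable_awalk)
  have "\<exists>p. awalk u p v \<and> length p = gdist G u v"
    unfolding gdist_def by (rule LeastI_ex) (use p0 in blast)
  then obtain p where p: "awalk u p v" "length p = gdist G u v" by blast
  have le: "gdist G u v \<le> length q" if "awalk u q v" for q
    unfolding gdist_def by (rule Least_le) (use that in blast)
  show ?thesis
    unfolding \<mu>_def cost
    by (rule INF_eqI) (use p le in force)+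
qed

lemma char_poly_ecc_matrix_enum:
  assumes "distinct vs" "distinct ws" "set vs = set ws"
  shows "char_poly (ecc_matrix G vs) = char_poly (ecc_matrix G ws)"
proof -
  define n where "n = length ws"
  have len: "length vs = n" "length ws = n"
    using assms by (metis distinct_card n_def)+
  define P :: "complex mat" where "P = mat n n (\<lambda>(i, j). if vs ! i = ws ! j then 1 else 0)"
  define Q :: "complex mat" where "Q = mat n n (\<lambda>(i, j). if ws ! i = vs ! j then 1 else 0)"
  let ?A = "ecc_matrix G vs" and ?B = "ecc_matrix G ws"
  have ex: "\<exists>k<n. vs ! i = ws ! k" "\<exists>k<n. ws ! i = vs ! k" if "i < n" for i
    using that assms(3) len by (metis in_set_conv_nth)+
  have inj: "vs ! i = vs ! j \<longleftrightarrow> i = j" "ws ! i = ws ! j \<longleftrightarrow> i = j" if "i < n" "j < n" for i j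
    using that assms len by (auto simp: nth_eq_iff_index_eq)
  have dims: "?A \<in> carrier_mat n n" "?B \<in> carrier_mat n n" "P \<in> carrier_mat n n"
    "Q \<in> carrier_mat n n"
    by (auto simp: ecc_matrix_def P_def Q_def len)
  have PQ: "P * Q = 1\<^sub>m n"
  proof (rule eq_matI, goal_cases)
    case (1 i j)
    then have ij: "i < n" "j < n" by auto
    obtain k where k: "k < n" "vs ! i = ws ! k" using ex(1)[OF ij(1)] by auto
    have "(P * Q) $$ (i, j) =
        (\<Sum>l = 0..<n. (if vs ! i = ws ! l then 1 else 0) * (if ws ! l = vs ! j then 1 else 0))"
      using ij by (simp add: P_def Q_def scalar_prod_def)
    also have "\<dots> = (\<Sum>l = 0..<n. (if l = k then if i = j then 1 else 0 else 0))"
    proof (rule sum.cong[OF refl])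
      fix l assume "l \<in> {0..<n}"
      then have "vs ! i = ws ! l \<longleftrightarrow> l = k"
        using inj(2)[of k l] k by auto
      moreover have "ws ! k = vs ! j \<longleftrightarrow> i = j"
        using inj(1)[OF ij] k by simp
      ultimately show "(if vs ! i = ws ! l then 1 else 0) * (if ws ! l = vs ! j then 1 else 0) =
          (if l = k then if i = j then 1 else 0 else (0 :: complex))"
        by auto
    qed
    finally have "(P * Q) $$ (i, j) = (\<Sum>l = 0..<n. (if l = k then if i = j then 1 else 0 else 0))" .
    then show ?case using ij k by (auto simp: one_mat_def)
  qed (auto simp: P_def Q_def)
  have QP: "Q * P = 1\<^sub>m n"
    by (rule mat_mult_left_right_inverse[OF dims(3,4) PQ])
  have AP: "?A * P = P * ?B"
  proof (rule eq_matI, goal_cases)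
    case (1 i j)
    then have ij: "i < n" "j < n" using dims by auto
    obtain k where k: "k < n" "vs ! i = ws ! k" using ex(1)[OF ij(1)] by auto
    obtain m where m: "m < n" "ws ! j = vs ! m" using ex(2)[OF ij(2)] by auto
    have "(?A * P) $$ (i, j) =
        (\<Sum>l = 0..<n. of_nat (ecc_entry G (vs ! i) (vs ! l)) * (if vs ! l = ws ! j then 1 else 0))"
      using ij by (simp add: P_def ecc_matrix_def scalar_prod_def len)
    also have "\<dots> = (\<Sum>l = 0..<n. (if l = m then of_nat (ecc_entry G (vs ! i) (vs ! m)) else 0))"
      by (rule sum.cong[OF refl]) (use inj m in auto)
    finally have "(?A * P) $$ (i, j) = of_nat (ecc_entry G (vs ! i) (ws ! j))"
      using m by simp
    moreover have "(P * ?B) $$ (i, j) =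
        (\<Sum>l = 0..<n. (if vs ! i = ws ! l then 1 else 0) * of_nat (ecc_entry G (ws ! l) (ws ! j)))"
      using ij by (simp add: P_def ecc_matrix_def scalar_prod_def len)
    moreover have "\<dots> = (\<Sum>l = 0..<n. (if l = k then of_nat (ecc_entry G (ws ! k) (ws ! j)) else 0))"
      by (rule sum.cong[OF refl]) (use inj k in auto)
    ultimately show ?case using k by simp
  qed (use dims in auto)
  have "P * ?B * Q = ?A * (P * Q)"
    unfolding AP[symmetric] using dims by (simp add: assoc_mult_mat[of _ n n _ n _ n])
  then have "?A = P * ?B * Q"
    using dims PQ by simp
  then have "similar_mat ?A ?B"
    using dims PQ QP by (intro similar_matI[of _ _ P Q n]) auto
  then show ?thesis by (rule char_poly_similar)
qed

lemma ecc_spectrum_eq: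
  assumes "distinct vs" "set vs = pverts G"
  shows "ecc_spectrum G = proots (char_poly (ecc_matrix G vs))"
proof -
  let ?P = "\<lambda>vs. distinct vs \<and> set vs = pverts G"
  have "?P (SOME vs. ?P vs)"
    by (rule someI[of ?P vs]) (use assms in auto)
  then show ?thesis
    unfolding ecc_spectrum_def using assms
    by (metis (no_types, lifting) char_poly_ecc_matrix_enum)
qed

end

(*
  Since the eccentricity matrix A is real symmetric, m(-1) is the dimension of the kernel of
  M = A + I. If m(-1) = n - 4, then every set S of five vertices supports a nonzero kernel
  vector of M, so M[S] is singular. This is contradicted by integer congruences.

  A vertex of eccentricity 1 exists: the entries of A between vertices of even eccentricity are
  even, so M is invertible modulo 2 on them and there are at most four; modulo 3, at most four
  have eccentricity divisible by 3. As n is at least 9, this excludes radius 2, where all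
  eccentricities are 2, 3 or 4. Four vertices whose mutual entries vanish are impossible unless
  some vertex has eccentricity 1: a kernel vector supported on them and a fifth vertex x would
  give 1 as the sum of the squares of the entries of x. This excludes radius at least 4
  (consecutive vertices of a geodesic) and bounds the degrees by 2 for radius 3, leaving at most
  7 vertices.

  With a dominating vertex k, subtracting its all-ones row turns M on the nondominating vertices
  into a Seidel matrix. Seidel matrices of order 4 are invertible modulo 2, so there are at most
  three nondominating vertices; the vectors e_t - e_k over dominating t show that there are at
  least three. The two resulting graphs are told apart by the eigenvalue 0.
*)

theory Submission
  imports Defs "Jordan_Normal_Form.Jordan_Normal_Form_Uniqueness"
    "Jordan_Normal_Form.Jordan_Normal_Form_Existence"
begin

section \<open>Linear algebra: kernels and multiplicities of eigenvalues\<close>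

text \<open>Gaussian elimination by induction on the set of equations: either the new equation
  \<open>t\<close> is void, or a pivot unknown \<open>c\<close> is eliminated from all the
  others.\<close>

lemma homogeneous_system_nontrivial:
  fixes F :: "'t \<Rightarrow> 'b \<Rightarrow> 'k :: field"
  assumes "finite T" "finite B" "card T < card B"
  shows "\<exists>a. (\<exists>b\<in>B. a b \<noteq> 0) \<and> (\<forall>t\<in>T. (\<Sum>b\<in>B. a b * F t b) = 0)"
  using assms
proof (induction T arbitrary: B F rule: finite_induct)
  case empty
  then have "B \<noteq> {}" by auto
  then show ?case by (intro exI[of _ "\<lambda>_. 1"]) auto
next
  case (insert t T)
  show ?case
  proof (cases "\<forall>b\<in>B. F t b = 0")
    case True
    obtain a where "\<exists>b\<in>B. a b \<noteq> 0" "\<forall>t\<in>T. (\<Sum>b\<in>B. a b * F t b) = 0"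
      using insert.IH[of B F] insert.prems insert.hyps by auto
    with True show ?thesis by (intro exI[of _ a]) auto
  next
    case False
    then obtain c where c: "c \<in> B" "F t c \<noteq> 0" by auto
    have card: "card T < card (B - {c})"
      using insert.prems insert.hyps c by (simp add: card_Diff_singleton)
    \<comment> \<open>Each equation loses the multiple of equation \<open>t\<close> that cancels the
      unknown \<open>c\<close>.\<close>
    define F' where "F' s b = F s b - F s c * F t b / F t c" for s b
    obtain a where a: "\<exists>b\<in>B - {c}. a b \<noteq> 0" "\<forall>s\<in>T. (\<Sum>b\<in>B - {c}. a b * F' s b) = 0"
      using insert.IH[of "B - {c}" F'] insert.prems card by auto
    \<comment> \<open>The value that equation \<open>t\<close> forces on the pivot unknown.\<close>
    define x where "x = - (\<Sum>b\<in>B - {c}. a b * F t b) / F t c"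
    define a' where "a' = a(c := x)"
    have sum: "(\<Sum>b\<in>B. a' b * F s b) = x * F s c + (\<Sum>b\<in>B - {c}. a b * F s b)" for s
      using c insert.prems by (subst sum.remove[of _ c]) (auto simp: a'_def intro!: sum.cong)
    have "(\<Sum>b\<in>B. a' b * F s b) = 0" if "s \<in> T" for s
    proof -
      have "0 = (\<Sum>b\<in>B - {c}. a b * F s b - F s c / F t c * (a b * F t b))"
        using a(2) that by (auto simp: F'_def algebra_simps)
      also have "\<dots> = (\<Sum>b\<in>B - {c}. a b * F s b) - F s c / F t c * (\<Sum>b\<in>B - {c}. a b * F t b)"
        by (simp only: sum_subtractf sum_distrib_left)
      finally show ?thesis
        unfolding sum by (simp add: x_def)
    qed
    moreover have "(\<Sum>b\<in>B. a' b * F t b) = 0"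
      unfolding sum using c by (simp add: x_def)
    moreover have "\<exists>b\<in>B. a' b \<noteq> 0"
      using a(1) by (auto simp: a'_def)
    ultimately show ?thesis by blast
  qed
qed

text \<open>If \<open>w = M v\<close> and \<open>M w = 0\<close>, moving the real symmetric
  \<open>M\<close> across the Hermitian product gives \<open>w \<bullet>c w = 0\<close>, hence
  \<open>w = 0\<close>. This supplies the hypothesis on Jordan blocks below.\<close>

lemma hermitian_kernel_square:
  fixes M :: "complex mat"
  assumes M: "M \<in> carrier_mat n n" and sym: "transpose_mat M = M"
    and re: "\<And>i j. i < n \<Longrightarrow> j < n \<Longrightarrow> cnj (M $$ (i, j)) = M $$ (i, j)"
  shows "mat_kernel (M * M) = mat_kernel M"
proof
  show "mat_kernel M \<subseteq> mat_kernel (M * M)"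
    using M by (auto simp: mat_kernel_def)
next
  show "mat_kernel (M * M) \<subseteq> mat_kernel M"
  proof
    fix v assume "v \<in> mat_kernel (M * M)"
    then have v: "v \<in> carrier_vec n" and MMv: "M *\<^sub>v (M *\<^sub>v v) = 0\<^sub>v n"
      using M by (auto simp: mat_kernel_def)
    define w where "w = M *\<^sub>v v"
    have w: "w \<in> carrier_vec n" using M v by (auto simp: w_def)
    have "w \<bullet>c w = conjugate w \<bullet> (M *\<^sub>v v)"
      using w by (simp add: w_def[symmetric] comm_scalar_prod[of _ n])
    also have "\<dots> = (M *\<^sub>v conjugate w) \<bullet> v"
      using transpose_vec_mult_scalar[OF M v, of "conjugate w"] w sym by simp
    \<comment> \<open>Real entries let \<open>M\<close> commute with conjugation.\<close>
    also have "M *\<^sub>v conjugate w = conjugate (M *\<^sub>v w)"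
    proof (rule eq_vecI)
      fix i assume "i < dim_vec (conjugate (M *\<^sub>v w))"
      then have i: "i < n" using M by simp
      show "(M *\<^sub>v conjugate w) $ i = conjugate (M *\<^sub>v w) $ i"
        using i M w re by (auto simp: scalar_prod_def intro!: sum.cong)
    qed (use M in auto)
    also have "\<dots> = 0\<^sub>v n" using MMv by (simp add: w_def)
    finally have "w = 0\<^sub>v n" using v w by (simp add: conjugate_square_eq_0_vec[OF w])
    then show "v \<in> mat_kernel M"
      using M v by (auto simp: w_def mat_kernel_def)
  qed
qed

text \<open>The hypothesis says that all Jordan blocks for \<open>e\<close> have size one.\<close>

lemma order_char_poly_eq_kernel_dim:
  fixes A :: "complex mat"
  assumes A: "A \<in> carrier_mat n n"
    and sq: "mat_kernel (char_matrix A e * char_matrix A e) = mat_kernel (char_matrix A e)"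
  shows "Polynomial.order e (char_poly A) = kernel_dim (char_matrix A e)"
proof -
  let ?M = "char_matrix A e"
  have M: "?M \<in> carrier_mat n n" using A by simp
  obtain as where "char_poly A = (\<Prod>a\<leftarrow>as. [:- a, 1:])"
    using char_poly_factorized[OF A] by blast
  then obtain n_as where jnf: "jordan_nf A n_as"
    using jordan_nf_exists[OF A] by blast
  \<comment> \<open>The sizes of the Jordan blocks for \<open>e\<close>.\<close>
  define L where "L = map fst [(n, a)\<leftarrow>n_as . a = e]"
  have dim: "dim_gen_eigenspace A e k = (\<Sum>n\<leftarrow>L. min k n)" for k
    using dim_gen_eigenspace[OF jnf, of e k] by (simp add: L_def)
  have "dim_gen_eigenspace A e 2 = kernel_dim (?M * ?M)"
    using M by (simp add: dim_gen_eigenspace_def numeral_2_eq_2)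
  also have "\<dots> = kernel_dim ?M"
    using M sq by (simp add: kernel_dim_def)
  also have "\<dots> = dim_gen_eigenspace A e 1"
    using M by (simp add: dim_gen_eigenspace_def)
  finally have "(\<Sum>n\<leftarrow>L. min 2 n) = (\<Sum>n\<leftarrow>L. min 1 n)" unfolding dim .
  \<comment> \<open>Equality forces every size to be at most 1. The sum of the sizes is the
    algebraic multiplicity, the other sum the geometric one.\<close>
  then have "(\<Sum>n\<leftarrow>L. n) = (\<Sum>n\<leftarrow>L. min 1 n)"
  proof (induction L)
    case (Cons a L)
    have "(\<Sum>n\<leftarrow>L. min 1 n) \<le> (\<Sum>n\<leftarrow>L. min 2 n)" by (rule sum_list_mono) auto
    with Cons show ?case by (cases "a \<le> 1") (auto simp: min_def)
  qed simp
  moreover have "Polynomial.order e (char_poly A) = (\<Sum>n\<leftarrow>L. n)"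
    using jordan_nf_order[OF jnf, of e] by (simp add: L_def split_def)
  ultimately show ?thesis
    using dim[of 1] M by (simp add: dim_gen_eigenspace_def)
qed

section \<open>Eigenfunctions of a symmetric weight function\<close>

locale symmetric_weights =
  fixes V :: "'a set" and w :: "'a \<Rightarrow> 'a \<Rightarrow> real" and vs :: "'a list"
  assumes enum: "distinct vs" "set vs = V"
    and sym: "\<And>u v. u \<in> V \<Longrightarrow> v \<in> V \<Longrightarrow> w u v = w v u"
begin

definition wmat :: "complex mat" where
  "wmat = mat (length vs) (length vs) (\<lambda>(i, j). of_real (w (vs ! i) (vs ! j)))"

text \<open>Eigenvectors become functions on the vertices, free of the enumeration. The zero
  function is included, so this describes the whole eigenspace.\<close>

definition eigenfun :: "real \<Rightarrow> ('a \<Rightarrow> complex) \<Rightarrow> bool" where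
  "eigenfun e f \<longleftrightarrow> (\<forall>u\<in>V. (\<Sum>v\<in>V. of_real (w u v) * f v) = of_real e * f u)"

lemma wmat_carrier: "wmat \<in> carrier_mat (length vs) (length vs)"
  by (simp add: wmat_def)

lemma finite_V: "finite V" and card_V: "card V = length vs"
  using enum by (auto simp: distinct_card)

lemma sum_index: "(\<Sum>i<length vs. g (vs ! i)) = (\<Sum>v\<in>V. g v)" for g :: "'a \<Rightarrow> 'b :: comm_monoid_add"
  using enum by (intro sum.reindex_bij_betw) (auto simp: bij_betw_nth)

abbreviation "cmat e \<equiv> char_matrix wmat (complex_of_real e)"

lemma cmat_carrier: "cmat e \<in> carrier_mat (length vs) (length vs)"
  using wmat_carrier by simp

lemma kernel_iff_eigenfun:
  assumes x: "x \<in> carrier_vec (length vs)" and f: "\<And>i. i < length vs \<Longrightarrow> f (vs ! i) = x $ i"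
  shows "x \<in> mat_kernel (cmat e) \<longleftrightarrow> eigenfun e f"
proof -
  let ?n = "length vs"
  have row: "(cmat e *\<^sub>v x) $ i
      = (\<Sum>v\<in>V. of_real (w (vs ! i) v) * f v) - of_real e * f (vs ! i)" if i: "i < ?n" for i
  proof -
    have "(cmat e *\<^sub>v x) $ i = (\<Sum>j<?n. cmat e $$ (i, j) * x $ j)"
      using i x carrier_matD[OF cmat_carrier[of e]] by (simp add: scalar_prod_def lessThan_atLeast0)
    also have "\<dots> = (\<Sum>j<?n. of_real (w (vs ! i) (vs ! j)) * f (vs ! j)
        - (if j = i then of_real e * f (vs ! i) else 0))"
      using i x f by (intro sum.cong) (auto simp: char_matrix_def wmat_def algebra_simps)
    also have "\<dots> = (\<Sum>v\<in>V. of_real (w (vs ! i) v) * f v) - of_real e * f (vs ! i)"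
      using i by (simp add: sum_subtractf sum_index[of "\<lambda>v. of_real (w (vs ! i) v) * f v"])
    finally show ?thesis .
  qed
  have "x \<in> mat_kernel (cmat e) \<longleftrightarrow> (\<forall>i<?n. (cmat e *\<^sub>v x) $ i = 0)"
    using x cmat_carrier[of e] by (auto simp: mat_kernel_def vec_eq_iff)
  also have "\<dots> \<longleftrightarrow> eigenfun e f"
    unfolding eigenfun_def
    using all_set_conv_all_nth[of vs "\<lambda>u. (\<Sum>v\<in>V. of_real (w u v) * f v) = of_real e * f u"]
    by (simp add: row enum(2))
  finally show ?thesis .
qed

text \<open>Subtracting a real multiple of the identity keeps the matrix real and symmetric, so
  algebraic and geometric multiplicity agree.\<close>

lemma order_eq_dim: "Polynomial.order (of_real e) (char_poly wmat) = kernel_dim (cmat e)"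
proof (rule order_char_poly_eq_kernel_dim[OF wmat_carrier])
  have "transpose_mat (cmat e) = cmat e"
    using enum sym by (intro eq_matI) (auto simp: char_matrix_def wmat_def)
  moreover have "cnj (cmat e $$ (i, j)) = cmat e $$ (i, j)"
    if "i < length vs" "j < length vs" for i j
    using that by (auto simp: char_matrix_def wmat_def)
  ultimately show "mat_kernel (cmat e * cmat e) = mat_kernel (cmat e)"
    using hermitian_kernel_square[OF cmat_carrier, of e] by blast
qed

text \<open>Dimension count: vanishing outside \<open>S\<close> imposes
  \<open>card V - card S\<close> linear conditions on the eigenspace, fewer than its dimension. High
  multiplicity is thereby turned into dependence among few columns.\<close>

lemma eigenfun_supported:
  assumes S: "S \<subseteq> V" and card: "card V < card S + Polynomial.order (of_real e) (char_poly wmat)"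
  obtains f where "eigenfun e f" "\<And>v. v \<notin> S \<Longrightarrow> f v = 0" "\<exists>v\<in>S. f v \<noteq> 0"
proof -
  let ?n = "length vs"
  interpret K: kernel ?n ?n "cmat e" by unfold_locales (rule cmat_carrier)
  obtain B where B: "finite B" "K.basis B"
    using kernel_basis_exists[OF cmat_carrier] by blast
  have BK: "B \<subseteq> mat_kernel (cmat e)" and indep: "K.lin_indpt B"
    using B(2) by (auto simp: K.Ker.basis_def)
  have cardB: "card B = Polynomial.order (of_real e) (char_poly wmat)"
    using K.Ker.dim_basis[OF B] by (simp add: order_eq_dim)
  define T where "T = {i. i < ?n \<and> vs ! i \<notin> S}"
  have "card T = card (V - S)"
  proof -
    have "bij_betw (\<lambda>i. vs ! i) T (V - S)"
      using enum by (auto simp: T_def bij_betw_def inj_on_def nth_eq_iff_index_eq in_set_conv_nth image_def)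
    then show ?thesis by (rule bij_betw_same_card)
  qed
  also have "\<dots> = card V - card S"
    using S finite_V by (intro card_Diff_subset) (auto intro: finite_subset)
  finally have "card T < card B"
    using card cardB card_mono[OF finite_V S] by linarith
  \<comment> \<open>The unknowns are coefficients over the basis \<open>B\<close>; the equations
    kill the coordinates in \<open>T\<close>.\<close>
  then obtain a where a: "\<exists>b\<in>B. a b \<noteq> 0" "\<forall>i\<in>T. (\<Sum>b\<in>B. a b * b $ i) = 0"
    using homogeneous_system_nontrivial[of T B "\<lambda>i b. b $ i"] B(1) by (auto simp: T_def)
  define x where "x = K.lincomb a B"
  have xK: "x \<in> mat_kernel (cmat e)"
    unfolding x_def using BK by (intro K.Ker.lincomb_closed) auto
  have x: "x \<in> carrier_vec ?n" using xK mat_kernel[OF cmat_carrier] by auto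
  have x0: "x \<noteq> 0\<^sub>v ?n"
    using a(1) indep B(1) BK unfolding x_def K.Ker.lin_dep_def by blast
  have xT: "x $ i = 0" if "i \<in> T" for i
    using K.lincomb_index[OF _ BK, of i a] a(2) that by (auto simp: x_def T_def)
  \<comment> \<open>\<open>THE\<close> recovers the index of a vertex; \<open>f\<close> is set to
    zero outside \<open>S\<close>, where \<open>x\<close> vanishes or has no coordinate.\<close>
  define f where "f v = (if v \<in> S then x $ (THE i. i < ?n \<and> vs ! i = v) else 0)" for v
  have idx: "(THE j. j < ?n \<and> vs ! j = vs ! i) = i" if "i < ?n" for i
    using that enum by (intro the_equality) (auto simp: nth_eq_iff_index_eq)
  have f: "f (vs ! i) = x $ i" if "i < ?n" for i
    using that xT[of i] by (auto simp: f_def idx T_def)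
  have "eigenfun e f" using kernel_iff_eigenfun[OF x f] xK by blast
  moreover have "\<exists>v\<in>S. f v \<noteq> 0"
  proof (rule ccontr)
    assume "\<not> ?thesis"
    then have "f v = 0" for v by (auto simp: f_def)
    then have "x $ i = 0" if "i < ?n" for i using f[OF that] by simp
    with x x0 show False by (auto simp: vec_eq_iff)
  qed
  ultimately show thesis using that[of f] by (simp add: f_def)
qed

text \<open>The functions \<open>F t\<close> are dual to evaluation at the points of
  \<open>T\<close>, hence linearly independent in the eigenspace.\<close>

lemma card_le_order:
  assumes T: "T \<subseteq> V" and F: "\<And>t. t \<in> T \<Longrightarrow> eigenfun e (F t)"
    and dual: "\<And>s t. s \<in> T \<Longrightarrow> t \<in> T \<Longrightarrow> F s t = (if s = t then 1 else 0)"
  shows "card T \<le> Polynomial.order (of_real e) (char_poly wmat)"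
proof -
  let ?n = "length vs"
  interpret K: kernel ?n ?n "cmat e" by unfold_locales (rule cmat_carrier)
  define x where "x t = vec ?n (\<lambda>i. F t (vs ! i))" for t
  have xK: "x t \<in> mat_kernel (cmat e)" if "t \<in> T" for t
    using kernel_iff_eigenfun[of "x t" "F t" e] F[OF that] by (simp add: x_def)
  obtain i where i: "\<And>t. t \<in> T \<Longrightarrow> i t < ?n" "\<And>t. t \<in> T \<Longrightarrow> vs ! i t = t"
  proof -
    have "\<forall>t\<in>T. \<exists>i. i < ?n \<and> vs ! i = t"
      using T enum(2) by (auto simp: in_set_conv_nth)
    then show thesis using that by (auto dest!: bchoice)
  qed
  have xi: "x s $ i t = (if s = t then 1 else 0)" if "s \<in> T" "t \<in> T" for s t
    using that i dual by (simp add: x_def)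
  have inj: "inj_on x T"
  proof (rule inj_onI)
    fix s t assume "s \<in> T" "t \<in> T" "x s = x t"
    then show "s = t" using xi[of s t] xi[of t t] by (auto split: if_splits)
  qed
  have finT: "finite T" using T finite_V by (rule finite_subset)
  have XK: "x ` T \<subseteq> mat_kernel (cmat e)" using xK by auto
  have "K.lin_indpt (x ` T)"
  proof (rule K.Ker.finite_lin_indpt2)
    fix a assume a: "K.lincomb a (x ` T) = 0\<^sub>v ?n"
    show "\<forall>v\<in>x ` T. a v = 0"
    proof
      fix v assume "v \<in> x ` T"
      then obtain t where t: "t \<in> T" "v = x t" by auto
      \<comment> \<open>Coordinate \<open>i t\<close> isolates the coefficient of
        \<open>x t\<close>.\<close>
      have "0 = K.lincomb a (x ` T) $ i t" using a t i by simp
      also have "\<dots> = (\<Sum>s\<in>T. a (x s) * x s $ i t)"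
        using K.lincomb_index[OF _ XK, of "i t" a] t i by (simp add: sum.reindex[OF inj])
      also have "\<dots> = (\<Sum>s\<in>T. if s = t then a (x t) else 0)"
        using t xi by (intro sum.cong) auto
      finally show "a v = 0" using t finT by simp
    qed
  qed (use finT XK in auto)
  moreover have "K.Ker.fin_dim"
    using kernel_basis_exists[OF cmat_carrier[of e]]
    by (auto simp: K.Ker.fin_dim_def K.Ker.basis_def)
  ultimately have "card (x ` T) \<le> K.dim"
    using K.Ker.li_le_dim(2) XK by blast
  then show ?thesis
    by (simp add: order_eq_dim card_image[OF inj])
qed

end

section \<open>Integer matrices with trivial kernel, by congruences\<close>

text \<open>Modulo \<open>p\<close> the matrix is diagonal and invertible. Instead of a determinant,
  the proof uses fraction-free elimination of one row and column at a time, which preserves this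
  shape.\<close>

lemma trivial_kernel_mod_prime:
  fixes C :: "'a \<Rightarrow> 'a \<Rightarrow> int" and f :: "'a \<Rightarrow> complex" and p :: int
  assumes "prime p" "finite S"
    and "\<And>u. u \<in> S \<Longrightarrow> \<not> p dvd C u u"
    and "\<And>u v. u \<in> S \<Longrightarrow> v \<in> S \<Longrightarrow> u \<noteq> v \<Longrightarrow> p dvd C u v"
    and "\<And>u. u \<in> S \<Longrightarrow> (\<Sum>v\<in>S. of_int (C u v) * f v) = 0"
  shows "\<forall>u\<in>S. f u = 0"
  using assms(2-5)
proof (induction S arbitrary: C rule: finite_induct)
  case (insert s S)
  have Css: "\<not> p dvd C s s" "C s s \<noteq> 0"
    using insert.prems(1)[of s] by auto
  \<comment> \<open>The Schur complement of the entry \<open>C s s\<close>, multiplied by that entry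
    to stay integral.\<close>
  define D where "D u v = C s s * C u v - C u s * C s v" for u v
  have "\<not> p dvd D u u" if u: "u \<in> S" for u
  proof
    assume "p dvd D u u"
    moreover have "p dvd C u s * C s u"
      using insert.prems(2)[of u s] insert.hyps u by (auto intro: dvd_mult2)
    ultimately have "p dvd C s s * C u u"
      unfolding D_def by (metis diff_add_cancel dvd_add)
    then show False
      using Css insert.prems(1)[of u] u \<open>prime p\<close> by (simp add: prime_dvd_mult_iff)
  qed
  moreover have "p dvd D u v" if "u \<in> S" "v \<in> S" "u \<noteq> v" for u v
    unfolding D_def using insert.prems(2)[of u v] insert.prems(2)[of u s] insert.hyps that
    by (intro dvd_diff dvd_mult dvd_mult2) auto
  moreover have row: "of_int (C u s) * f s + (\<Sum>v\<in>S. of_int (C u v) * f v) = 0"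
    if "u \<in> insert s S" for u
    using insert.prems(3)[OF that] insert.hyps by simp
  have "(\<Sum>v\<in>S. of_int (D u v) * f v) = 0" if "u \<in> S" for u
  proof -
    have "(\<Sum>v\<in>S. of_int (D u v) * f v)
        = (\<Sum>v\<in>S. of_int (C s s) * (of_int (C u v) * f v) - of_int (C u s) * (of_int (C s v) * f v))"
      by (intro sum.cong) (auto simp: D_def algebra_simps)
    also have "\<dots> = of_int (C s s) * (\<Sum>v\<in>S. of_int (C u v) * f v)
        - of_int (C u s) * (\<Sum>v\<in>S. of_int (C s v) * f v)"
      by (simp only: sum_subtractf sum_distrib_left)
    also have "(\<Sum>v\<in>S. of_int (C u v) * f v) = - of_int (C u s) * f s"
      using row[of u] that by (simp add: eq_neg_iff_add_eq_0 add.commute)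
    also have "(\<Sum>v\<in>S. of_int (C s v) * f v) = - of_int (C s s) * f s"
      using row[of s] by (simp add: eq_neg_iff_add_eq_0 add.commute)
    finally show ?thesis by (simp add: algebra_simps)
  qed
  ultimately have fS: "\<forall>u\<in>S. f u = 0"
    using insert.IH[of D] by blast
  moreover have "f s = 0"
    using row[of s] fS Css(2) by simp
  ultimately show ?case by blast
qed simp

text \<open>Modulo 2 the square of a Seidel matrix of even order is the identity matrix.\<close>

lemma seidel_trivial_kernel:
  fixes C :: "'a \<Rightarrow> 'a \<Rightarrow> int" and f :: "'a \<Rightarrow> complex"
  assumes fin: "finite Q" and card: "even (card Q)"
    and diag: "\<And>u. u \<in> Q \<Longrightarrow> C u u = 0"
    and off: "\<And>u v. u \<in> Q \<Longrightarrow> v \<in> Q \<Longrightarrow> u \<noteq> v \<Longrightarrow> odd (C u v)"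
    and ker: "\<And>u. u \<in> Q \<Longrightarrow> (\<Sum>v\<in>Q. of_int (C u v) * f v) = 0"
  shows "\<forall>u\<in>Q. f u = 0"
proof (rule trivial_kernel_mod_prime[of 2 Q "\<lambda>u x. \<Sum>v\<in>Q. C u v * C v x"])
  \<comment> \<open>The criterion is applied to the square of \<open>C\<close>. A summand is odd
    exactly when \<open>v\<close> differs from both \<open>u\<close> and \<open>x\<close>, so
    entries are odd on the diagonal and even off it.\<close>
  have parity: "even (\<Sum>v\<in>Q. C u v * C v x) \<longleftrightarrow> even (card (Q - {u, x}))"
    if "u \<in> Q" "x \<in> Q" for u x
  proof -
    have "{v \<in> Q. odd (C u v * C v x)} = Q - {u, x}"
    proof (intro Set.set_eqI iffI)
      fix v assume "v \<in> Q - {u, x}"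
      then show "v \<in> {v \<in> Q. odd (C u v * C v x)}"
        using off[of u v] off[of v x] that by auto
    qed (use that diag in auto)
    then show ?thesis using even_sum_iff[OF fin, of "\<lambda>v. C u v * C v x"] by simp
  qed
  show "\<not> 2 dvd (\<Sum>v\<in>Q. C u v * C v u)" if "u \<in> Q" for u
  proof -
    have "0 < card Q" using that fin by (auto simp: card_gt_0_iff)
    then have "odd (card Q - 1)" using card by simp
    then show ?thesis
      using parity[OF that that] that fin by (simp add: card_Diff_subset)
  qed
  show "2 dvd (\<Sum>v\<in>Q. C u v * C v x)" if "u \<in> Q" "x \<in> Q" "u \<noteq> x" for u x
    using parity[OF that(1,2)] that fin card by (simp add: card_Diff_subset)
  show "(\<Sum>x\<in>Q. of_int (\<Sum>v\<in>Q. C u v * C v x) * f x) = 0" if "u \<in> Q" for u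
  proof -
    have "(\<Sum>x\<in>Q. of_int (\<Sum>v\<in>Q. C u v * C v x) * f x)
        = (\<Sum>x\<in>Q. \<Sum>v\<in>Q. of_int (C u v) * (of_int (C v x) * f x))"
      by (simp add: sum_distrib_right mult.assoc)
    also have "\<dots> = (\<Sum>v\<in>Q. of_int (C u v) * (\<Sum>x\<in>Q. of_int (C v x) * f x))"
      unfolding sum_distrib_left by (rule sum.swap)
    finally show ?thesis using ker by simp
  qed
qed (use fin in auto)

section \<open>Distances, eccentricities and entries of the eccentricity matrix\<close>

locale connected_pair_graph = pair_graph +
  assumes graph_connected: "Digraph_Component.connected (with_proj G)"
begin

abbreviation "d \<equiv> gdist G"

abbreviation "ecc \<equiv> eccentricity G"

text \<open>Symmetry of the arcs upgrades connectedness to strong connectedness, so the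
  \<open>LEAST\<close> in \<open>gdist\<close> ranges over a nonempty set and is attained.\<close>

lemma ex_shortest_awalk:
  assumes "u \<in> pverts G" "v \<in> pverts G"
  obtains p where "awalk u p v" "length p = d u v"
proof -
  have "strongly_connected (with_proj G)"
    using symmetric_connected_imp_strongly_connected[OF sym_arcs graph_connected] .
  then have "u \<rightarrow>\<^sup>*\<^bsub>with_proj G\<^esub> v"
    using assms by (auto simp: strongly_connected_def)
  then obtain q where "awalk u q v"
    by (auto simp: reachable_awalk)
  then have "\<exists>p. awalk u p v \<and> length p = d u v"
    unfolding gdist_def using LeastI_ex[of "\<lambda>k. \<exists>p. awalk u p v \<and> length p = k"] by blast
  with that show thesis by blast
qed

lemma gdist_le: "awalk u p v \<Longrightarrow> d u v \<le> length p"
  unfolding gdist_def by (rule Least_le) blast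

lemma gdist_self [simp]: "u \<in> pverts G \<Longrightarrow> d u u = 0"
  using gdist_le[of u "[]" u] by (simp add: awalk_simps)

lemma gdist_eq_0_iff: "u \<in> pverts G \<Longrightarrow> v \<in> pverts G \<Longrightarrow> d u v = 0 \<longleftrightarrow> u = v"
  by (metis awalk_Nil_iff ex_shortest_awalk gdist_self length_0_conv)

lemma gdist_triangle:
  assumes "u \<in> pverts G" "v \<in> pverts G" "x \<in> pverts G"
  shows "d u x \<le> d u v + d v x"
proof -
  obtain p q where "awalk u p v" "length p = d u v" "awalk v q x" "length q = d v x"
    using assms by (metis ex_shortest_awalk)
  then show ?thesis
    using gdist_le[OF awalk_appendI, of u p v q x] by simp
qed

lemma gdist_arc_le: "(u, v) \<in> parcs G \<Longrightarrow> d u v \<le> 1"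
  using gdist_le[of u "[(u, v)]" v] by (simp add: awalk_simps in_arcsD2)

lemma arcs_commute: "(u, v) \<in> parcs G \<longleftrightarrow> (v, u) \<in> parcs G"
  using sym_arcs by (auto simp: symmetric_def sym_def)

text \<open>The first arc of a shortest walk; the triangle inequality shows that the rest is again
  shortest. This allows induction on the distance.\<close>

lemma gdist_Suc:
  assumes "u \<in> pverts G" "v \<in> pverts G" "d u v = Suc k"
  obtains x where "(u, x) \<in> parcs G" "d x v = k"
proof -
  obtain p where p: "awalk u p v" "length p = Suc k"
    using assms by (metis ex_shortest_awalk)
  then obtain e q where eq: "p = e # q" by (cases p) auto
  have e: "(u, snd e) \<in> parcs G" "awalk (snd e) q v"
    using p eq by (auto simp: awalk_simps)
  have "snd e \<in> pverts G" using e(1) by (rule in_arcsD2)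
  then have "d u v \<le> 1 + d (snd e) v"
    using gdist_triangle[of u "snd e" v] gdist_arc_le[OF e(1)] assms by simp
  moreover have "d (snd e) v \<le> k"
    using gdist_le[OF e(2)] p eq by simp
  ultimately show thesis using that[OF e(1)] assms by simp
qed

lemma gdist_eq_1_iff:
  assumes "u \<in> pverts G" "v \<in> pverts G"
  shows "d u v = 1 \<longleftrightarrow> (u, v) \<in> parcs G"
proof
  assume "d u v = 1"
  then obtain x where "(u, x) \<in> parcs G" "d x v = 0"
    using gdist_Suc assms by (metis One_nat_def)
  then show "(u, v) \<in> parcs G"
    using gdist_eq_0_iff assms in_arcsD2 by metis
next
  assume a: "(u, v) \<in> parcs G"
  then have "u \<noteq> v" using pair_no_loops by force
  then show "d u v = 1"
    using gdist_arc_le[OF a] gdist_eq_0_iff assms by (simp add: le_Suc_eq)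
qed

text \<open>Induction along a shortest walk, reversing one arc at a time.\<close>

lemma gdist_rev_le:
  assumes "u \<in> pverts G" "v \<in> pverts G"
  shows "d v u \<le> d u v"
  using assms
proof (induction "d u v" arbitrary: u)
  case 0
  then show ?case by (metis gdist_eq_0_iff le_refl)
next
  case (Suc k)
  then obtain x where x: "(u, x) \<in> parcs G" "d x v = k"
    using gdist_Suc by metis
  then have xV: "x \<in> pverts G" by (auto dest: in_arcsD2)
  have "d v u \<le> d v x + d x u"
    using Suc xV gdist_triangle by blast
  also have "d x u \<le> 1"
    using x gdist_arc_le arcs_commute by blast
  also have "d v x \<le> k"
    using Suc.hyps(1)[of x] x Suc.prems xV by simp
  finally show ?case using Suc by simp
qed

lemma gdist_commute:
  assumes "u \<in> pverts G" "v \<in> pverts G"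
  shows "d u v = d v u"
  using gdist_rev_le assms by (meson order_antisym)

lemma gdist_le_ecc:
  assumes "u \<in> pverts G" "v \<in> pverts G"
  shows "d u v \<le> ecc u" "d u v \<le> ecc v"
proof -
  have *: "d x y \<le> ecc x" if "y \<in> pverts G" for x y
    using that pair_finite_verts by (auto simp: eccentricity_def)
  then show "d u v \<le> ecc u" using assms by blast
  show "d u v \<le> ecc v" using *[of u v] gdist_commute assms by metis
qed

lemma ecc_attained:
  assumes "u \<in> pverts G"
  obtains v where "v \<in> pverts G" "d u v = ecc u"
proof -
  have "ecc u \<in> d u ` pverts G"
    unfolding eccentricity_def by (rule Max_in) (use assms pair_finite_verts in auto)
  with that show thesis by auto
qed

text \<open>A detour through \<open>v\<close>. For radius 2 this bounds all eccentricities by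
  4.\<close>

lemma ecc_le_double:
  assumes "u \<in> pverts G" "v \<in> pverts G"
  shows "ecc u \<le> 2 * ecc v"
proof -
  obtain x where x: "x \<in> pverts G" "d u x = ecc u"
    using assms ecc_attained by metis
  have "d u x \<le> d u v + d v x" using assms x gdist_triangle by blast
  also have "\<dots> \<le> ecc v + ecc v" using assms x gdist_le_ecc by (meson add_mono)
  finally show ?thesis using x by simp
qed

lemma ecc_pos:
  assumes "u \<in> pverts G" "2 \<le> card (pverts G)"
  shows "1 \<le> ecc u"
proof -
  obtain v where "v \<in> pverts G" "v \<noteq> u"
    using assms card_mono[of "{u}" "pverts G"] by fastforce
  then show ?thesis
    using assms gdist_le_ecc(1)[of u v] gdist_eq_0_iff[of u v] by simp
qed

text \<open>At least two vertices are required: an only vertex has eccentricity 0 although it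
  dominates vacuously.\<close>

lemma ecc_eq_1_iff:
  assumes "u \<in> pverts G" "2 \<le> card (pverts G)"
  shows "ecc u = 1 \<longleftrightarrow> (\<forall>v\<in>pverts G. v \<noteq> u \<longrightarrow> (u, v) \<in> parcs G)"
proof
  assume e: "ecc u = 1"
  show "\<forall>v\<in>pverts G. v \<noteq> u \<longrightarrow> (u, v) \<in> parcs G"
  proof (intro ballI impI)
    fix v assume v: "v \<in> pverts G" "v \<noteq> u"
    then have "d u v = 1"
      using e assms gdist_le_ecc(1)[of u v] gdist_eq_0_iff[of u v] by simp
    then show "(u, v) \<in> parcs G" using gdist_eq_1_iff v assms by blast
  qed
next
  assume adj: "\<forall>v\<in>pverts G. v \<noteq> u \<longrightarrow> (u, v) \<in> parcs G"
  obtain v where v: "v \<in> pverts G" "d u v = ecc u"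
    using assms ecc_attained by metis
  then have "ecc u \<le> 1"
    using adj gdist_arc_le[of u v] assms by (cases "v = u") auto
  then show "ecc u = 1" using ecc_pos assms by (simp add: order_antisym)
qed

lemma ecc_entry_self [simp]: "u \<in> pverts G \<Longrightarrow> ecc_entry G u u = 0"
  by (simp add: ecc_entry_def)

lemma ecc_entry_commute:
  "u \<in> pverts G \<Longrightarrow> v \<in> pverts G \<Longrightarrow> ecc_entry G u v = ecc_entry G v u"
  by (simp add: ecc_entry_def gdist_commute min.commute)

lemma ecc_entry_eq_0:
  assumes "d u v < min (ecc u) (ecc v)"
  shows "ecc_entry G u v = 0"
  unfolding ecc_entry_def using less_imp_neq[OF assms] by simp

text \<open>Nonzero entries thus inherit every divisor and lower bound common to both
  eccentricities.\<close>

lemma ecc_entry_eq_min_or_0: "ecc_entry G u v = 0 \<or> ecc_entry G u v = min (ecc u) (ecc v)"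
  by (simp add: ecc_entry_def)

lemma ecc_entry_dominating:
  assumes "u \<in> pverts G" "v \<in> pverts G" "u \<noteq> v" "ecc u = 1" "2 \<le> card (pverts G)"
  shows "ecc_entry G u v = 1"
proof -
  have "d u v = 1"
    using assms ecc_eq_1_iff[of u] gdist_eq_1_iff[of u v] by auto
  moreover have "1 \<le> ecc v" using assms ecc_pos by blast
  ultimately show ?thesis using assms(4) by (simp add: ecc_entry_def)
qed

end

section \<open>Existence of a dominating vertex when m(-1) = n - 4\<close>

locale enumerated_connected_graph = connected_pair_graph +
  fixes vs :: "'a list"
  assumes enum_distinct: "distinct vs" and enum_set: "set vs = pverts G"
begin

sublocale symmetric_weights "pverts G" "\<lambda>u v. real (ecc_entry G u v)" vs
  by unfold_locales (auto simp: enum_distinct enum_set ecc_entry_commute)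

lemma wmat_eq: "wmat = ecc_matrix G vs"
  by (auto simp: wmat_def ecc_matrix_def)

definition mult :: "real \<Rightarrow> nat" where
  "mult e = Polynomial.order (of_real e) (char_poly wmat)"

lemma char_poly_nonzero: "char_poly wmat \<noteq> 0"
  using degree_monic_char_poly[OF wmat_carrier] by auto

lemma count_ecc_spectrum: "count (ecc_spectrum G) (of_real e) = mult e"
  using ecc_spectrum_eq[OF enum_distinct enum_set] char_poly_nonzero
  by (simp add: mult_def wmat_eq)

lemma size_ecc_spectrum: "size (ecc_spectrum G) = card (pverts G)"
  using ecc_spectrum_eq[OF enum_distinct enum_set] degree_monic_char_poly[OF wmat_carrier]
  by (simp add: wmat_eq size_proots_complex card_V)

text \<open>This is the eccentricity matrix plus the identity, kept over the integers so that its
  entries can be reduced modulo primes.\<close>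

definition M :: "'a \<Rightarrow> 'a \<Rightarrow> int" where
  "M u v = int (ecc_entry G u v) + (if u = v then 1 else 0)"

text \<open>When m(-1) = n - 4, any five vertices qualify as \<open>S\<close>. The equation holds in
  every row, also in those outside \<open>S\<close>.\<close>

lemma M_kernel_supported:
  assumes S: "S \<subseteq> pverts G" and card: "card (pverts G) < card S + mult (-1)"
  obtains f where "\<And>u. u \<in> pverts G \<Longrightarrow> (\<Sum>v\<in>S. of_int (M u v) * f v) = (0 :: complex)"
    "\<exists>v\<in>S. f v \<noteq> 0"
proof -
  obtain f where f: "eigenfun (-1) f" "\<And>v. v \<notin> S \<Longrightarrow> f v = 0" "\<exists>v\<in>S. f v \<noteq> 0"
    using eigenfun_supported[OF S, of "-1"] card unfolding mult_def by blast
  have "(\<Sum>v\<in>S. of_int (M u v) * f v) = 0" if u: "u \<in> pverts G" for u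
  proof -
    have "(\<Sum>v\<in>S. of_int (M u v) * f v) = (\<Sum>v\<in>pverts G. of_int (M u v) * f v)"
      using S finite_V f(2) by (intro sum.mono_neutral_left) auto
    also have "\<dots> = (\<Sum>v\<in>pverts G. of_real (real (ecc_entry G u v)) * f v + (if v = u then f u else 0))"
      by (intro sum.cong) (auto simp: M_def algebra_simps)
    also have "\<dots> = 0"
      using f(1) u finite_V by (simp add: sum.distrib eigenfun_def)
    finally show ?thesis .
  qed
  with f(3) that show thesis by blast
qed

text \<open>Between vertices whose eccentricities are multiples of \<open>p\<close>, an entry is 0
  or one of these multiples, so \<open>M\<close> reduces to the identity modulo
  \<open>p\<close>.\<close>

lemma card_prime_dvd_ecc:
  assumes p: "prime p"
  shows "card {v \<in> pverts G. p dvd ecc v} + mult (-1) \<le> card (pverts G)"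
proof (rule ccontr)
  let ?S = "{v \<in> pverts G. p dvd ecc v}"
  assume "\<not> ?thesis"
  then obtain f where f: "\<And>u. u \<in> pverts G \<Longrightarrow> (\<Sum>v\<in>?S. of_int (M u v) * f v) = (0 :: complex)"
    "\<exists>v\<in>?S. f v \<noteq> 0"
    using M_kernel_supported[of ?S] by auto
  have "\<forall>v\<in>?S. f v = 0"
  proof (rule trivial_kernel_mod_prime[of "int p" ?S M])
    show "\<not> int p dvd M u u" if "u \<in> ?S" for u
      using that p by (auto simp: M_def)
    show "int p dvd M u v" if "u \<in> ?S" "v \<in> ?S" "u \<noteq> v" for u v
      using that ecc_entry_eq_min_or_0[of u v] by (auto simp: M_def min_def)
  qed (use p f finite_V in auto)
  with f(2) show False by blast
qed

text \<open>On \<open>Q\<close> the matrix \<open>M\<close> is the identity. Adding a fifth vertex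
  \<open>x\<close> and eliminating \<open>Q\<close> leaves 1 minus the sum of the squared entries of
  \<open>x\<close>, which must vanish; but a nonzero entry is at least 2.\<close>

lemma no_four_with_zero_entries:
  assumes m: "mult (-1) + 4 = card (pverts G)" and n: "5 \<le> card (pverts G)"
    and ecc: "\<And>v. v \<in> pverts G \<Longrightarrow> 2 \<le> ecc v"
    and Q: "Q \<subseteq> pverts G" "card Q = 4"
    and zero: "\<And>u v. u \<in> Q \<Longrightarrow> v \<in> Q \<Longrightarrow> u \<noteq> v \<Longrightarrow> ecc_entry G u v = 0"
  shows False
proof -
  have finQ: "finite Q" using Q finite_V finite_subset by blast
  have "\<not> pverts G \<subseteq> Q" using n Q card_mono[OF finQ] by fastforce
  then obtain x where x: "x \<in> pverts G" "x \<notin> Q" by blast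
  obtain f where f: "\<And>u. u \<in> pverts G \<Longrightarrow> (\<Sum>v\<in>insert x Q. of_int (M u v) * f v) = (0 :: complex)"
    "\<exists>v\<in>insert x Q. f v \<noteq> 0"
    using M_kernel_supported[of "insert x Q"] x Q m finQ by auto
  let ?b = "\<lambda>q. ecc_entry G x q"
  \<comment> \<open>Row \<open>q\<close> involves only the unknowns \<open>f q\<close> and
    \<open>f x\<close>.\<close>
  have fq: "f q = - of_nat (?b q) * f x" if q: "q \<in> Q" for q
  proof -
    have "(\<Sum>v\<in>Q. of_int (M q v) * f v) = (\<Sum>v\<in>Q. if v = q then f q else 0)"
      using q Q zero by (intro sum.cong) (auto simp: M_def)
    then have "of_int (M q x) * f x + f q = 0"
      using f(1)[of q] q Q x finQ by (auto simp: subset_iff)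
    moreover have "M q x = int (?b q)"
      using q x Q ecc_entry_commute[of q x] by (auto simp: M_def)
    ultimately show ?thesis by (simp add: eq_neg_iff_add_eq_0 add.commute)
  qed
  then have fx: "f x \<noteq> 0" using f(2) by auto
  have prod: "of_int (M x q) * f q = - (f x * of_nat (?b q ^ 2))" if "q \<in> Q" for q
  proof -
    have "x \<noteq> q" using x that by blast
    then show ?thesis by (simp add: M_def fq[OF that] power2_eq_square)
  qed
  have "(\<Sum>q\<in>Q. of_int (M x q) * f q) = (\<Sum>q\<in>Q. - (f x * of_nat (?b q ^ 2)))"
    using prod by (rule sum.cong[OF refl])
  also have "\<dots> = - (f x * of_nat (\<Sum>q\<in>Q. ?b q ^ 2))"
    by (simp add: sum_negf sum_distrib_left)
  finally have "f x = f x * of_nat (\<Sum>q\<in>Q. ?b q ^ 2)"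
    using f(1)[OF x(1)] x finQ by (simp add: M_def)
  then have "(of_nat (\<Sum>q\<in>Q. ?b q ^ 2) :: complex) = of_nat 1" using fx by simp
  then have one: "(\<Sum>q\<in>Q. ?b q ^ 2) = 1" unfolding of_nat_eq_iff .
  then obtain q where q: "q \<in> Q" "?b q \<noteq> 0"
    by (cases "\<forall>q\<in>Q. ?b q = 0") auto
  then have "2 \<le> ?b q"
    using ecc_entry_eq_min_or_0[of x q] ecc x Q by (auto simp: subset_iff)
  then have "2\<^sup>2 \<le> ?b q ^ 2" by (rule power_mono) simp
  also have "\<dots> \<le> (\<Sum>q\<in>Q. ?b q ^ 2)" using q finQ by (intro member_le_sum) auto
  finally show False using one by simp
qed

text \<open>A distance below the lower bound \<open>r\<close> is smaller than both eccentricities,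
  so the corresponding entry is zero.\<close>

lemma no_four_close:
  assumes m: "mult (-1) + 4 = card (pverts G)" and n: "5 \<le> card (pverts G)"
    and r: "2 \<le> r" "\<And>v. v \<in> pverts G \<Longrightarrow> r \<le> ecc v"
    and Q: "Q \<subseteq> pverts G" "card Q = 4"
    and close: "\<And>u v. u \<in> Q \<Longrightarrow> v \<in> Q \<Longrightarrow> d u v < r"
  shows False
proof (rule no_four_with_zero_entries[OF m n _ Q])
  show "2 \<le> ecc v" if "v \<in> pverts G" for v using r(1) r(2)[OF that] by simp
  show "ecc_entry G u v = 0" if "u \<in> Q" "v \<in> Q" for u v
    using close[OF that] r(2)[of u] r(2)[of v] Q that
    by (intro ecc_entry_eq_0) (auto simp: subset_iff intro: less_le_trans)
qed

text \<open>If all eccentricities were at least 4, the first four vertices of a geodesic from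
  \<open>c\<close> to a farthest vertex \<open>y\<close> would lie at mutual distance at most
  3.\<close>

lemma radius_less_4:
  assumes m: "mult (-1) + 4 = card (pverts G)" and n: "5 \<le> card (pverts G)"
    and c: "c \<in> pverts G"
  shows "\<exists>v\<in>pverts G. ecc v < 4"
proof (rule ccontr)
  assume "\<not> ?thesis"
  then have r: "\<And>v. v \<in> pverts G \<Longrightarrow> 4 \<le> ecc v" by force
  obtain y where y: "y \<in> pverts G" "d c y = ecc c" using ecc_attained[OF c] by blast
  obtain k where k: "d c y = Suc (Suc (Suc (Suc k)))"
    using r[OF c] y by (metis Suc_numeral add_2_eq_Suc' le_add_diff_inverse2 numeral_Bit0 numeral_One add_Suc_right numeral_2_eq_2)
  obtain x1 where x1: "(c, x1) \<in> parcs G" "d x1 y = Suc (Suc (Suc k))"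
    using gdist_Suc[OF c y(1) k] by blast
  have x1V: "x1 \<in> pverts G" using x1(1) by (rule in_arcsD2)
  obtain x2 where x2: "(x1, x2) \<in> parcs G" "d x2 y = Suc (Suc k)"
    using gdist_Suc[OF x1V y(1) x1(2)] by blast
  have x2V: "x2 \<in> pverts G" using x2(1) by (rule in_arcsD2)
  obtain x3 where x3: "(x2, x3) \<in> parcs G" "d x3 y = Suc k"
    using gdist_Suc[OF x2V y(1) x2(2)] by blast
  have x3V: "x3 \<in> pverts G" using x3(1) by (rule in_arcsD2)
  note V = c x1V x2V x3V
  have d1: "d c x1 \<le> 1" "d x1 x2 \<le> 1" "d x2 x3 \<le> 1"
    using gdist_arc_le x1 x2 x3 by blast+
  have d2: "d c x2 \<le> 2" "d x1 x3 \<le> 2"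
    using gdist_triangle[of c x1 x2] gdist_triangle[of x1 x2 x3] V d1 by auto
  have d3: "d c x3 \<le> 3" using gdist_triangle[of c x2 x3] V d1 d2 by auto
  have le: "d u v < 4" if "u \<in> {c, x1, x2, x3}" "v \<in> {c, x1, x2, x3}" for u v
    using that V d1 d2 d3 gdist_commute[of x1 c] gdist_commute[of x2 c] gdist_commute[of x3 c]
      gdist_commute[of x2 x1] gdist_commute[of x3 x1] gdist_commute[of x3 x2] by auto
  \<comment> \<open>Their distances to \<open>y\<close> are four different numbers.\<close>
  have "distinct [c, x1, x2, x3]" using k x1 x2 x3 by auto
  then have "card {c, x1, x2, x3} = 4" by simp
  then show False
    using no_four_close[OF m n, of 4 "{c, x1, x2, x3}"] r V le by auto
qed

text \<open>A vertex and three of its neighbours have mutual distance at most 2, so all degrees are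
  at most 2. The distance levels around the centre \<open>c\<close> then have sizes at most 1, 2, 2,
  2.\<close>

lemma not_radius_3:
  assumes m: "mult (-1) + 4 = card (pverts G)" and n: "8 \<le> card (pverts G)"
    and r: "\<And>v. v \<in> pverts G \<Longrightarrow> 3 \<le> ecc v"
    and c: "c \<in> pverts G" "ecc c = 3"
  shows False
proof -
  define N where "N u = {x. (u, x) \<in> parcs G}" for u
  have NV: "N u \<subseteq> pverts G" for u by (auto simp: N_def dest: in_arcsD2)
  have finN: "finite (N u)" for u using NV finite_V by (rule finite_subset)
  have deg: "card (N u) \<le> 2" if u: "u \<in> pverts G" for u
  proof (rule ccontr)
    assume "\<not> ?thesis"
    then obtain T where T: "T \<subseteq> N u" "card T = 3" "finite T"
      using obtain_subset_with_card_n[of 3 "N u"] finN by (metis finite_subset not_less_eq_eq numeral_2_eq_2 numeral_3_eq_3)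
    have "u \<notin> T" using T pair_no_loops by (force simp: N_def)
    then have "card (insert u T) = 4" using T by simp
    moreover have near: "x \<in> pverts G" "d u x \<le> 1" "d x u \<le> 1" if "x \<in> insert u T" for x
      using that u T NV gdist_arc_le[of u x] gdist_commute[of u x] by (auto simp: N_def subset_iff)
    moreover have "d x y < 3" if "x \<in> insert u T" "y \<in> insert u T" for x y
    proof -
      have "d x y \<le> d x u + d u y" using near that u by (intro gdist_triangle)
      also have "\<dots> \<le> 1 + 1" using near that by (intro add_mono)
      finally show ?thesis by simp
    qed
    ultimately show False
      using no_four_close[OF m _ _ r, of "insert u T"] n by auto
  qed
  define L where "L k = {v \<in> pverts G. d v c = k}" for k
  have finL: "finite (L k)" for k using finite_V by (simp add: L_def)
  have L0: "card (L 0) \<le> 1"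
    using c gdist_eq_0_iff by (intro card_le_Suc0_iff_eq[THEN iffD2, folded One_nat_def] finL) (auto simp: L_def)
  have L1: "card (L 1) \<le> 2"
  proof -
    have "L 1 \<subseteq> N c" using c gdist_eq_1_iff arcs_commute by (auto simp: L_def N_def)
    then show ?thesis using card_mono[OF finN] deg[OF c(1)] le_trans by blast
  qed
  \<comment> \<open>A vertex of level \<open>Suc k\<close> has a neighbour in level
    \<open>k\<close>, which leaves at most one neighbour for the next level.\<close>
  have step: "card (L (Suc (Suc k))) \<le> card (L (Suc k))" for k
  proof -
    have "L (Suc (Suc k)) \<subseteq> (\<Union>u\<in>L (Suc k). N u \<inter> L (Suc (Suc k)))"
    proof
      fix v assume v: "v \<in> L (Suc (Suc k))"
      then obtain x where "(v, x) \<in> parcs G" "d x c = Suc k"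
        using gdist_Suc[of v c "Suc k"] c by (auto simp: L_def)
      then show "v \<in> (\<Union>u\<in>L (Suc k). N u \<inter> L (Suc (Suc k)))"
        using v arcs_commute by (auto simp: L_def N_def dest: in_arcsD2)
    qed
    then have "card (L (Suc (Suc k))) \<le> card (\<Union>u\<in>L (Suc k). N u \<inter> L (Suc (Suc k)))"
      using finL by (intro card_mono) auto
    also have "\<dots> \<le> (\<Sum>u\<in>L (Suc k). card (N u \<inter> L (Suc (Suc k))))"
      using finL by (intro card_UN_le) auto
    also have "\<dots> \<le> (\<Sum>u\<in>L (Suc k). 1)"
    proof (rule sum_mono)
      fix u assume u: "u \<in> L (Suc k)"
      then obtain x where x: "(u, x) \<in> parcs G" "d x c = k"
        using gdist_Suc[of u c k] c by (auto simp: L_def)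
      have "card (N u \<inter> L (Suc (Suc k))) \<le> card (N u - {x})"
        using x finN by (intro card_mono) (auto simp: L_def)
      also have "\<dots> \<le> 1" using deg[of u] u x by (simp add: L_def N_def)
      finally show "card (N u \<inter> L (Suc (Suc k))) \<le> 1" .
    qed
    finally show ?thesis by simp
  qed
  have "pverts G \<subseteq> L 0 \<union> L 1 \<union> L 2 \<union> L 3"
  proof
    fix v assume v: "v \<in> pverts G"
    then have "d v c \<le> 3" using gdist_le_ecc(2)[of v c] c by simp
    then have "d v c \<in> {0, 1, 2, 3}" by auto
    with v show "v \<in> L 0 \<union> L 1 \<union> L 2 \<union> L 3" by (auto simp: L_def)
  qed
  then have "card (pverts G) \<le> card (L 0 \<union> L 1 \<union> L 2 \<union> L 3)"
    using finL by (intro card_mono) auto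
  also have "\<dots> \<le> card (L 0) + card (L 1) + card (L 2) + card (L 3)"
    by (meson add_mono card_Un_le le_refl le_trans)
  also have "\<dots> \<le> 7"
    using L0 L1 step[of 0] step[of 1] by (simp add: numeral_2_eq_2 numeral_3_eq_3)
  finally show False using n by simp
qed

text \<open>Otherwise the radius \<open>r\<close> is at least 2, and the two preceding lemmas reduce
  it to exactly 2.\<close>

lemma ex_dominating_vertex:
  assumes m: "mult (-1) + 4 = card (pverts G)" and n: "9 \<le> card (pverts G)"
  shows "\<exists>v\<in>pverts G. ecc v = 1"
proof (rule ccontr)
  assume no: "\<not> ?thesis"
  have ecc2: "2 \<le> ecc v" if "v \<in> pverts G" for v
    using ecc_pos[OF that] no that n by force
  define r where "r = Min (ecc ` pverts G)"
  have ne: "pverts G \<noteq> {}" using n by auto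
  have "r \<in> ecc ` pverts G" unfolding r_def using ne finite_V by (intro Min_in) auto
  then obtain c where c: "c \<in> pverts G" "ecc c = r" by auto
  have r: "r \<le> ecc v" if "v \<in> pverts G" for v
    unfolding r_def using that finite_V by (intro Min_le) auto
  obtain v where v: "v \<in> pverts G" "ecc v < 4"
    using radius_less_4[OF m _ c(1)] n by auto
  have "r < 4" using r[OF v(1)] v(2) by simp
  moreover have "r \<noteq> 3"
  proof
    assume "r = 3"
    then show False using not_radius_3[OF m _ _ c(1)] c(2) n r by simp
  qed
  ultimately have r2: "r = 2" using ecc2[OF c(1)] c(2) by linarith
  \<comment> \<open>The eccentricities are 2, 3 or 4, so the classes for the primes 2 and 3 cover
    all vertices, each with at most four.\<close>
  have "pverts G \<subseteq> {v \<in> pverts G. 2 dvd ecc v} \<union> {v \<in> pverts G. 3 dvd ecc v}"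
  proof
    fix v assume v: "v \<in> pverts G"
    then have "ecc v \<le> 4" using ecc_le_double[of v c] c r2 by simp
    then have "ecc v \<in> {2, 3, 4}" using ecc2[OF v] by auto
    with v show "v \<in> {v \<in> pverts G. 2 dvd ecc v} \<union> {v \<in> pverts G. 3 dvd ecc v}" by auto
  qed
  then have "card (pverts G) \<le> card ({v \<in> pverts G. 2 dvd ecc v} \<union> {v \<in> pverts G. 3 dvd ecc v})"
    using finite_V by (intro card_mono) auto
  also have "\<dots> \<le> card {v \<in> pverts G. 2 dvd ecc v} + card {v \<in> pverts G. 3 dvd ecc v}"
    by (rule card_Un_le)
  also have "\<dots> \<le> 4 + 4"
    using card_prime_dvd_ecc[of 2] card_prime_dvd_ecc[of 3] m by (intro add_mono) auto
  finally show False using n by simp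
qed

end

section \<open>Graphs with exactly three nondominating vertices\<close>

text \<open>
  The only non-adjacent pairs lie in \<open>{a, b, c}\<close>, where at most \<open>a\<close> and \<open>b\<close> are adjacent: they
  are if \<open>q\<close> holds (\<open>K_{n-3} \<or> (K_2 \<union> K_1)\<close>), and otherwise the graph is \<open>K_{n-3} \<or> 3K_1\<close>.
\<close>

definition co_triple :: "bool \<Rightarrow> 'a pair_pre_digraph \<Rightarrow> 'a \<Rightarrow> 'a \<Rightarrow> 'a \<Rightarrow> bool" where
  "co_triple q G a b c \<longleftrightarrow> distinct [a, b, c] \<and> {a, b, c} \<subseteq> pverts G \<and>
     parcs G = {(u, v). u \<in> pverts G \<and> v \<in> pverts G \<and> u \<noteq> v \<and>
       (u \<in> {a, b, c} \<and> v \<in> {a, b, c} \<longrightarrow> q \<and> {u, v} = {a, b})}"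

context connected_pair_graph
begin

text \<open>The dominating vertex \<open>k\<close> bounds every eccentricity by 2, so both
  eccentricities here are exactly 2 and only distance 2 survives in the matrix.\<close>

lemma ecc_entry_nondominating:
  assumes k: "k \<in> pverts G" "ecc k = 1" and n: "2 \<le> card (pverts G)"
    and u: "u \<in> pverts G" "ecc u \<noteq> 1" and v: "v \<in> pverts G" "ecc v \<noteq> 1" and uv: "u \<noteq> v"
  shows "ecc_entry G u v = (if (u, v) \<in> parcs G then 0 else 2)"
proof -
  have e: "ecc u = 2" "ecc v = 2"
    using ecc_le_double[of u k] ecc_le_double[of v k] ecc_pos[of u] ecc_pos[of v] k n u v by auto
  have "d u v \<noteq> 0" "d u v \<le> 2"
    using gdist_eq_0_iff[of u v] gdist_le_ecc(1)[of u v] u v uv e by auto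
  moreover have "d u v = 1 \<longleftrightarrow> (u, v) \<in> parcs G"
    using gdist_eq_1_iff u v by blast
  ultimately show ?thesis using e by (auto simp: ecc_entry_def)
qed

text \<open>Whatever \<open>q\<close> is, \<open>c\<close> is adjacent to neither \<open>a\<close>
  nor \<open>b\<close>, so none of the three dominates.\<close>

lemma co_triple_dominating:
  assumes "co_triple q G a b c" "2 \<le> card (pverts G)"
  shows "{v \<in> pverts G. ecc v = 1} = pverts G - {a, b, c}"
proof -
  have *: "ecc v = 1 \<longleftrightarrow> v \<notin> {a, b, c}" if v: "v \<in> pverts G" for v
  proof
    assume "ecc v = 1"
    then have adj: "\<forall>x\<in>pverts G. x \<noteq> v \<longrightarrow> (v, x) \<in> parcs G"
      using ecc_eq_1_iff[OF v assms(2)] by blast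
    have "(a, c) \<notin> parcs G" "(b, c) \<notin> parcs G" "(c, a) \<notin> parcs G"
      "a \<in> pverts G" "b \<in> pverts G" "c \<in> pverts G" "distinct [a, b, c]"
      using assms(1) by (auto simp: co_triple_def doubleton_eq_iff)
    with adj show "v \<notin> {a, b, c}" by auto
  next
    assume "v \<notin> {a, b, c}"
    then show "ecc v = 1"
      using assms v by (subst ecc_eq_1_iff) (auto simp: co_triple_def)
  qed
  then show ?thesis by blast
qed

text \<open>On the three nondominating vertices the complement has no isolated vertex, so it
  contains a path with two edges. Its centre plays the role of \<open>c\<close>, and
  \<open>q\<close> tells whether the ends are adjacent in \<open>G\<close>.\<close>

lemma co_triple_if_three_nondominating:
  assumes n: "4 \<le> card (pverts G)" and R: "card {v \<in> pverts G. ecc v \<noteq> 1} = 3"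
  shows "\<exists>q a b c. co_triple q G a b c"
proof -
  let ?R = "{v \<in> pverts G. ecc v \<noteq> 1}"
  have n2: "2 \<le> card (pverts G)" using n by simp
  \<comment> \<open>The non-neighbour \<open>y\<close> of \<open>x\<close> is itself nondominating,
    so it lies in the triple.\<close>
  have co: "\<exists>y\<in>?R. y \<noteq> x \<and> (x, y) \<notin> parcs G" if x: "x \<in> ?R" for x
  proof -
    obtain y where y: "y \<in> pverts G" "y \<noteq> x" "(x, y) \<notin> parcs G"
      using x ecc_eq_1_iff[OF _ n2, of x] by auto
    then have "ecc y \<noteq> 1" using ecc_eq_1_iff[OF y(1) n2] x arcs_commute by auto
    with y show ?thesis by blast
  qed
  have dom: "(u, v) \<in> parcs G" if "u \<in> pverts G" "v \<in> pverts G" "u \<noteq> v" "\<not> (u \<in> ?R \<and> v \<in> ?R)" for u v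
  proof -
    have "ecc u = 1 \<or> ecc v = 1" using that by blast
    then show ?thesis
      using that(1-3) ecc_eq_1_iff[OF that(1) n2] ecc_eq_1_iff[OF that(2) n2] arcs_commute[of u v]
      by auto
  qed
  have loop: "(u, u) \<notin> parcs G" for u using pair_no_loops by force
  have build: "co_triple q G a b c" if "?R = {a, b, c}" "distinct [a, b, c]"
    "(a, c) \<notin> parcs G" "(b, c) \<notin> parcs G" "q \<longleftrightarrow> (a, b) \<in> parcs G" for a b c q
  proof -
    have sub: "{a, b, c} \<subseteq> pverts G" using that(1) by blast
    have in_R: "(u, v) \<in> parcs G \<longleftrightarrow> q \<and> {u, v} = {a, b}"
      if "u \<in> {a, b, c}" "v \<in> {a, b, c}" for u v
      using that \<open>distinct [a, b, c]\<close> \<open>(a, c) \<notin> parcs G\<close> \<open>(b, c) \<notin> parcs G\<close> \<open>q \<longleftrightarrow> (a, b) \<in> parcs G\<close>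
        loop arcs_commute by (auto simp: doubleton_eq_iff)
    have "(u, v) \<in> parcs G \<longleftrightarrow> u \<in> pverts G \<and> v \<in> pverts G \<and> u \<noteq> v \<and>
       (u \<in> {a, b, c} \<and> v \<in> {a, b, c} \<longrightarrow> q \<and> {u, v} = {a, b})" for u v
    proof (cases "u \<in> {a, b, c} \<and> v \<in> {a, b, c}")
      case True
      then show ?thesis using in_R[of u v] sub that(2) loop by auto
    next
      case False
      then show ?thesis using dom[of u v] that(1) loop in_arcsD1 in_arcsD2 by metis
    qed
    then have "parcs G = {(u, v). u \<in> pverts G \<and> v \<in> pverts G \<and> u \<noteq> v \<and>
       (u \<in> {a, b, c} \<and> v \<in> {a, b, c} \<longrightarrow> q \<and> {u, v} = {a, b})}" by blast
    with sub that(2) show ?thesis unfolding co_triple_def by blast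
  qed
  obtain x y z where xyz: "?R = {x, y, z}" "distinct [x, y, z]"
    using R unfolding card_3_iff by auto
  have "(x, y) \<notin> parcs G \<or> (x, z) \<notin> parcs G" "(y, x) \<notin> parcs G \<or> (y, z) \<notin> parcs G"
    "(z, x) \<notin> parcs G \<or> (z, y) \<notin> parcs G"
    using co[of x] co[of y] co[of z] unfolding xyz(1) by auto
  moreover have "\<exists>q. co_triple q G x y z" if "(x, z) \<notin> parcs G" "(y, z) \<notin> parcs G"
    using build[OF xyz that refl] by blast
  moreover have "\<exists>q. co_triple q G x z y" if "(x, y) \<notin> parcs G" "(z, y) \<notin> parcs G"
    using build[of x z y "(x, z) \<in> parcs G"] xyz that by (auto simp: insert_commute)
  moreover have "\<exists>q. co_triple q G y z x" if "(y, x) \<notin> parcs G" "(z, x) \<notin> parcs G"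
    using build[of y z x "(y, z) \<in> parcs G"] xyz that by (auto simp: insert_commute)
  ultimately show ?thesis
    using arcs_commute[of x y] arcs_commute[of x z] arcs_commute[of y z] by blast
qed

end

section \<open>Counting dominating and nondominating vertices by m(-1)\<close>

context enumerated_connected_graph
begin

lemma M_dominating:
  assumes "k \<in> pverts G" "ecc k = 1" "2 \<le> card (pverts G)" "v \<in> pverts G"
  shows "M k v = 1" "M v k = 1"
  using assms ecc_entry_dominating[of k v] ecc_entry_commute[of v k] by (auto simp: M_def)

text \<open>For four nondominating vertices \<open>Q\<close> and \<open>k\<close>, subtracting the
  all-ones row of \<open>k\<close> eliminates \<open>f k\<close> and turns the entries 0 and 2 of
  \<open>M\<close> into -1 and 1. The result is a Seidel matrix of even order, with trivial
  kernel.\<close>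

lemma card_nondominating_le:
  assumes k: "k \<in> pverts G" "ecc k = 1" and n: "card (pverts G) < mult (-1) + 5"
  shows "card {v \<in> pverts G. ecc v \<noteq> 1} \<le> 3"
proof (rule ccontr)
  let ?R = "{v \<in> pverts G. ecc v \<noteq> 1}"
  assume "\<not> ?thesis"
  then have "4 \<le> card ?R" by simp
  then obtain Q where Q: "Q \<subseteq> ?R" "card Q = 4" "finite Q"
    by (rule obtain_subset_with_card_n)
  have kQ: "k \<notin> Q" using k Q by auto
  have "card (insert k Q) \<le> card (pverts G)" using k Q finite_V by (intro card_mono) auto
  then have n2: "2 \<le> card (pverts G)" using Q kQ by simp
  obtain f where f: "\<And>u. u \<in> pverts G \<Longrightarrow> (\<Sum>v\<in>insert k Q. of_int (M u v) * f v) = (0 :: complex)"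
    "\<exists>v\<in>insert k Q. f v \<noteq> 0"
    using M_kernel_supported[of "insert k Q"] k Q kQ n by auto
  have row_k: "f k + (\<Sum>v\<in>Q. f v) = 0"
  proof -
    have "(\<Sum>v\<in>Q. of_int (M k v) * f v) = (\<Sum>v\<in>Q. f v)"
      using Q M_dominating(1)[OF k n2] by (intro sum.cong) auto
    then show ?thesis using f(1)[OF k(1)] Q kQ M_dominating(1)[OF k n2 k(1)] by simp
  qed
  have "\<forall>v\<in>Q. f v = 0"
  proof (rule seidel_trivial_kernel[of Q "\<lambda>u v. M u v - 1"])
    show "M u u - 1 = 0" if "u \<in> Q" for u using that Q by (auto simp: M_def)
    show "odd (M u v - 1)" if "u \<in> Q" "v \<in> Q" "u \<noteq> v" for u v
      using that Q ecc_entry_nondominating[OF k n2, of u v] by (auto simp: M_def subset_iff)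
    show "(\<Sum>v\<in>Q. of_int (M u v - 1) * f v) = 0" if u: "u \<in> Q" for u
    proof -
      have "u \<in> pverts G" using u Q by auto
      then have "f k + (\<Sum>v\<in>Q. of_int (M u v) * f v) = 0"
        using f(1)[of u] Q kQ M_dominating(2)[OF k n2, of u] by simp
      then have "(\<Sum>v\<in>Q. of_int (M u v) * f v) = (\<Sum>v\<in>Q. f v)"
        using row_k by (metis add_left_imp_eq)
      then show ?thesis by (simp add: left_diff_distrib sum_subtractf)
    qed
  qed (use Q in auto)
  with row_k f(2) show False by auto
qed

text \<open>Dominating vertices have identical rows and columns of ones in \<open>M\<close>, so the
  difference of the indicators of \<open>t\<close> and \<open>k\<close> is an eigenfunction for -1.
  The summand 1 accounts for the fixed \<open>k\<close>.\<close>

lemma card_dominating_le: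
  assumes k: "k \<in> pverts G" "ecc k = 1" and n2: "2 \<le> card (pverts G)"
  shows "card {v \<in> pverts G. ecc v = 1} \<le> mult (-1) + 1"
proof -
  let ?D = "{v \<in> pverts G. ecc v = 1}"
  define F where "F t v = (if v = t then 1 else 0) - (if v = k then 1 else 0 :: complex)" for t v
  have "card (?D - {k}) \<le> mult (-1)"
    unfolding mult_def
  proof (rule card_le_order)
    show "?D - {k} \<subseteq> pverts G" by blast
    show "F s t = (if s = t then 1 else 0)" if "s \<in> ?D - {k}" "t \<in> ?D - {k}" for s t
      using that by (auto simp: F_def)
    show "eigenfun (-1) (F t)" if t: "t \<in> ?D - {k}" for t
      unfolding eigenfun_def
    proof
      fix u assume u: "u \<in> pverts G"
      have "(\<Sum>v\<in>pverts G. of_real (real (ecc_entry G u v)) * F t v)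
          = (\<Sum>v\<in>pverts G. (if v = t then of_nat (ecc_entry G u t) else 0)
              - (if v = k then of_nat (ecc_entry G u k) else 0))"
        by (intro sum.cong) (auto simp: F_def)
      also have "\<dots> = of_nat (ecc_entry G u t) - of_nat (ecc_entry G u k)"
        using t k finite_V by (simp add: sum_subtractf)
      also have "\<dots> = - F t u"
        using t k u n2 ecc_entry_dominating[of t u] ecc_entry_dominating[of k u]
          ecc_entry_commute[of u t] ecc_entry_commute[of u k] by (auto simp: F_def)
      finally show "(\<Sum>v\<in>pverts G. of_real (real (ecc_entry G u v)) * F t v) = of_real (-1) * F t u"
        by simp
    qed
  qed
  then show ?thesis using k finite_V by (simp add: card_Diff_singleton)
qed

text \<open>At most \<open>n - 3\<close> vertices dominate and at most 3 do not, so both bounds are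
  attained.\<close>

lemma co_triple_if_mult:
  assumes m: "mult (-1) + 4 = card (pverts G)" and n: "9 \<le> card (pverts G)"
  shows "\<exists>q a b c. co_triple q G a b c"
proof (rule co_triple_if_three_nondominating)
  obtain k where k: "k \<in> pverts G" "ecc k = 1" using ex_dominating_vertex[OF m n] by blast
  have "card (pverts G) = card ({v \<in> pverts G. ecc v = 1} \<union> {v \<in> pverts G. ecc v \<noteq> 1})"
    by (rule arg_cong[of _ _ card]) blast
  also have "\<dots> = card {v \<in> pverts G. ecc v = 1} + card {v \<in> pverts G. ecc v \<noteq> 1}"
    using finite_V by (intro card_Un_disjoint) auto
  finally show "card {v \<in> pverts G. ecc v \<noteq> 1} = 3"
    using card_nondominating_le[OF k] card_dominating_le[OF k] m n by linarith
qed (use n in simp)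

section \<open>The eigenvalues -1 and 0 of the two graphs\<close>

context
  fixes q a b c k
  assumes co: "co_triple q G a b c" and k: "k \<in> pverts G - {a, b, c}"
    and card4: "4 \<le> card (pverts G)"
begin

lemma co_triple_vertices:
  "a \<in> pverts G" "b \<in> pverts G" "c \<in> pverts G" "a \<noteq> b" "a \<noteq> c" "b \<noteq> c"
  using co by (auto simp: co_triple_def)

lemma co_triple_ecc:
  assumes "v \<in> pverts G"
  shows "ecc v = 1 \<longleftrightarrow> v \<notin> {a, b, c}"
  using co_triple_dominating[OF co] card4 assms by auto

lemma co_triple_entry_dominating:
  assumes "u \<in> pverts G - {a, b, c}" "v \<in> pverts G" "u \<noteq> v"
  shows "ecc_entry G u v = 1" "ecc_entry G v u = 1"
  using assms ecc_entry_dominating[of u v] ecc_entry_commute[of u v] co_triple_ecc[of u] card4 by auto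

lemma co_triple_entries:
  "ecc_entry G a b = (if q then 0 else 2)" "ecc_entry G a c = 2" "ecc_entry G b c = 2"
  "ecc_entry G b a = (if q then 0 else 2)" "ecc_entry G c a = 2" "ecc_entry G c b = 2"
proof -
  have *: "ecc_entry G u v = (if (u, v) \<in> parcs G then 0 else 2)"
    if "u \<in> {a, b, c}" "v \<in> {a, b, c}" "u \<noteq> v" for u v
    using that k card4 co_triple_vertices co_triple_ecc[of k] co_triple_ecc[of u] co_triple_ecc[of v]
    by (intro ecc_entry_nondominating[of k]) auto
  have "(a, b) \<in> parcs G \<longleftrightarrow> q" "(a, c) \<notin> parcs G" "(b, c) \<notin> parcs G"
    "(b, a) \<in> parcs G \<longleftrightarrow> q" "(c, a) \<notin> parcs G" "(c, b) \<notin> parcs G"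
    using co by (auto simp: co_triple_def doubleton_eq_iff)
  then show "ecc_entry G a b = (if q then 0 else 2)" "ecc_entry G a c = 2" "ecc_entry G b c = 2"
    "ecc_entry G b a = (if q then 0 else 2)" "ecc_entry G c a = 2" "ecc_entry G c b = 2"
    using co_triple_vertices by (simp_all add: *)
qed

text \<open>The dominating vertices provide multiplicity at least \<open>n - 4\<close>. A larger one
  would give a nonzero kernel vector supported on \<open>{k, a, b, c}\<close>, where
  \<open>M\<close> is invertible.\<close>

lemma co_triple_mult: "mult (-1) + 4 = card (pverts G)"
proof (rule antisym)
  have kV: "k \<in> pverts G" "ecc k = 1" using k co_triple_ecc by auto
  have "card (pverts G - {a, b, c}) = card (pverts G) - 3"
    using co_triple_vertices finite_V by (simp add: card_Diff_subset)
  then show "card (pverts G) \<le> mult (-1) + 4"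
    using card_dominating_le[OF kV] co_triple_dominating[OF co] card4 by simp
  show "mult (-1) + 4 \<le> card (pverts G)"
  proof (rule ccontr)
    assume "\<not> ?thesis"
    moreover have neq: "k \<noteq> a" "k \<noteq> b" "k \<noteq> c" using k by auto
    ultimately have card: "card (pverts G) < card {k, a, b, c} + mult (-1)"
      using co_triple_vertices by simp
    have sub: "{k, a, b, c} \<subseteq> pverts G" using kV co_triple_vertices by blast
    obtain f where f: "\<And>u. u \<in> pverts G \<Longrightarrow> (\<Sum>v\<in>{k, a, b, c}. of_int (M u v) * f v) = (0 :: complex)"
      "\<exists>v\<in>{k, a, b, c}. f v \<noteq> 0"
    proof (rule M_kernel_supported[OF sub card])
      fix f assume f: "\<And>u. u \<in> pverts G \<Longrightarrow> (\<Sum>v\<in>{k, a, b, c}. of_int (M u v) * f v) = (0 :: complex)"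
        "\<exists>v\<in>{k, a, b, c}. f v \<noteq> 0"
      show thesis by (rule that[OF f])
    qed
    \<comment> \<open>The entry between \<open>a\<close> and \<open>b\<close>, the only one that
      depends on \<open>q\<close>; in both cases \<open>s - 1\<close> is a sign, hence
      nonzero.\<close>
    define s :: complex where "s = (if q then 0 else 2)"
    have M: "M k k = 1" "M k a = 1" "M k b = 1" "M k c = 1" "M a k = 1" "M b k = 1" "M c k = 1"
      using M_dominating[OF kV] card4 co_triple_vertices kV by auto
    have M': "M a a = 1" "M b b = 1" "M c c = 1" "of_int (M a b) = s" "of_int (M b a) = s"
      "M a c = 2" "M b c = 2" "M c a = 2" "M c b = 2"
      using co_triple_vertices by (auto simp: M_def co_triple_entries s_def)
    have sum: "(\<Sum>v\<in>{k, a, b, c}. g v) = g k + g a + g b + g c" for g :: "'a \<Rightarrow> complex"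
      using neq co_triple_vertices by (simp add: add.assoc)
    have row_k: "f k + f a + f b + f c = 0"
      using f(1)[OF kV(1)] unfolding sum by (simp add: M)
    have row_a: "f k + f a + s * f b + 2 * f c = 0"
      using f(1)[of a] co_triple_vertices unfolding sum by (simp add: M M')
    \<comment> \<open>Subtracting row \<open>k\<close> from row \<open>a\<close>; rows
      \<open>b\<close> and \<open>c\<close> are treated alike.\<close>
    have "(s - 1) * f b + f c = (f k + f a + s * f b + 2 * f c) - (f k + f a + f b + f c)"
      by (simp add: algebra_simps)
    then have sb: "(s - 1) * f b + f c = 0" unfolding row_a row_k by simp
    have row_b: "f k + s * f a + f b + 2 * f c = 0"
      using f(1)[of b] co_triple_vertices unfolding sum by (simp add: M M')
    have "(s - 1) * f a + f c = (f k + s * f a + f b + 2 * f c) - (f k + f a + f b + f c)"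
      by (simp add: algebra_simps)
    then have sa: "(s - 1) * f a + f c = 0" unfolding row_b row_k by simp
    have row_c: "f k + 2 * f a + 2 * f b + f c = 0"
      using f(1)[of c] co_triple_vertices unfolding sum by (simp add: M M')
    have "f a + f b = (f k + 2 * f a + 2 * f b + f c) - (f k + f a + f b + f c)"
      by (simp add: algebra_simps)
    then have ab: "f a + f b = 0" unfolding row_c row_k by simp
    have "(s - 1) * f a = (s - 1) * f b" using sa sb by (metis add_right_imp_eq)
    moreover have "s - 1 \<noteq> 0" by (simp add: s_def)
    ultimately have "f a = f b" using mult_left_cancel by blast
    with ab have "f a = 0" "f b = 0" by simp_all
    with sa row_k have "f c = 0" "f k = 0" by simp_all
    note zero = this \<open>f a = 0\<close> \<open>f b = 0\<close>
    from zero f(2) show False by auto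
  qed
qed

text \<open>If \<open>q\<close> holds, \<open>a\<close> and \<open>b\<close> have equal rows, and
  the difference of their indicators is an eigenfunction for 0. Otherwise an eigenfunction is
  constant on the triple and takes the opposite value elsewhere, which is consistent only if there
  are 4 dominating vertices, that is, for order 7.\<close>

lemma co_triple_zero_eigenvalue:
  assumes n7: "card (pverts G) \<noteq> 7"
  shows "0 < mult 0 \<longleftrightarrow> q"
proof
  assume q
  define F where "F v = (if v = a then 1 else 0) - (if v = b then 1 else 0 :: complex)" for v
  have "card {a} \<le> mult 0"
    unfolding mult_def
  proof (rule card_le_order)
    show "eigenfun 0 F"
      unfolding eigenfun_def
    proof
      fix u assume u: "u \<in> pverts G"
      have "(\<Sum>v\<in>pverts G. of_real (real (ecc_entry G u v)) * F v)
          = (\<Sum>v\<in>pverts G. (if v = a then of_nat (ecc_entry G u a) else 0)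
              - (if v = b then of_nat (ecc_entry G u b) else 0))"
        by (intro sum.cong) (auto simp: F_def)
      also have "\<dots> = of_nat (ecc_entry G u a) - of_nat (ecc_entry G u b)"
        using co_triple_vertices finite_V by (simp add: sum_subtractf)
      also have "\<dots> = 0"
        using \<open>q\<close> u co_triple_vertices co_triple_entry_dominating(1)[of u a]
          co_triple_entry_dominating(1)[of u b]
        by (cases "u \<in> {a, b, c}") (auto simp: co_triple_entries)
      finally show "(\<Sum>v\<in>pverts G. of_real (real (ecc_entry G u v)) * F v) = of_real 0 * F u"
        by simp
    qed
  qed (use co_triple_vertices in \<open>auto simp: F_def\<close>)
  then show "0 < mult 0" by simp
next
  assume m: "0 < mult 0"
  show q
  proof (rule ccontr)
    assume "\<not> q"
    obtain f where f: "eigenfun 0 f" "\<exists>v\<in>pverts G. f v \<noteq> 0"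
    proof (rule eigenfun_supported[of "pverts G" 0])
      show "card (pverts G) < card (pverts G) + Polynomial.order (of_real 0) (char_poly wmat)"
        using m unfolding mult_def by linarith
    qed (use that in auto)
    let ?D = "pverts G - {a, b, c}"
    have split: "(\<Sum>v\<in>pverts G. g v) = g a + g b + g c + (\<Sum>v\<in>?D. g v)" for g :: "'a \<Rightarrow> complex"
    proof -
      have "(\<Sum>v\<in>pverts G. g v) = (\<Sum>v\<in>{a, b, c}. g v) + (\<Sum>v\<in>?D. g v)"
        using co_triple_vertices finite_V by (subst sum.subset_diff[of "{a, b, c}"]) (auto simp: add.commute)
      then show ?thesis using co_triple_vertices by (simp add: add.assoc)
    qed
    have row: "(\<Sum>v\<in>pverts G. of_nat (ecc_entry G u v) * f v) = 0" if "u \<in> pverts G" for u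
      using f(1) that by (simp add: eigenfun_def)
    have tri: "of_nat (ecc_entry G u a) * f a + of_nat (ecc_entry G u b) * f b
        + of_nat (ecc_entry G u c) * f c + (\<Sum>v\<in>?D. f v) = 0" if "u \<in> {a, b, c}" for u
    proof -
      have "(\<Sum>v\<in>?D. of_nat (ecc_entry G u v) * f v) = (\<Sum>v\<in>?D. f v)"
        using that co_triple_vertices co_triple_entry_dominating(2)
        by (intro sum.cong) auto
      then show ?thesis
        using row[of u] that co_triple_vertices split[of "\<lambda>v. of_nat (ecc_entry G u v) * f v"] by auto
    qed
    define t where "t = (\<Sum>v\<in>?D. f v)"
    have abc: "2 * f b + 2 * f c + t = 0" "2 * f a + 2 * f c + t = 0" "2 * f a + 2 * f b + t = 0"
      using tri[of a] tri[of b] tri[of c] \<open>\<not> q\<close> co_triple_vertices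
      by (simp_all add: co_triple_entries t_def)
    \<comment> \<open>The row of a dominating vertex sums \<open>f\<close> over all other vertices,
      so \<open>f u\<close> equals the total sum.\<close>
    have fD: "f u = f a + f b + f c + t" if u: "u \<in> ?D" for u
    proof -
      have "(\<Sum>v\<in>pverts G. of_nat (ecc_entry G u v) * f v) = (\<Sum>v\<in>pverts G. f v - (if v = u then f u else 0))"
        using u co_triple_entry_dominating(1)[of u] by (intro sum.cong) auto
      also have "\<dots> = f a + f b + f c + t - f u"
        using u finite_V by (simp add: sum_subtractf split[of f] t_def)
      finally show ?thesis using row[of u] u by simp
    qed
    have eqs: "f b = f a" "f c = f a" "t = - 4 * f a" 
    proof -
      have "2 * f b = 2 * f a" using abc(1,2) by (metis add_right_imp_eq)
      then show ba: "f b = f a" by simp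
      have "2 * f c = 2 * f a" using abc(1,3) by (metis add.commute add_right_imp_eq)
      then show "f c = f a" by simp
      with ba abc(1) show "t = - 4 * f a" by (simp add: add_eq_0_iff)
    qed
    \<comment> \<open>On \<open>?D\<close> the value of \<open>f\<close> is
      \<open>3 * f a - 4 * f a\<close>.\<close>
    have "t = (\<Sum>v\<in>?D. - f a)"
      unfolding t_def using fD eqs by (intro sum.cong) auto
    also have "\<dots> = - of_nat (card ?D) * f a" by simp
    finally have "of_nat (card ?D) * f a = of_nat 4 * f a" using eqs(3) by simp
    moreover have "card ?D \<noteq> 4"
      using co_triple_vertices finite_V n7 card4 by (simp add: card_Diff_subset)
    ultimately have "f a = 0" by (metis mult_right_cancel of_nat_eq_iff)
    then have "f v = 0" if "v \<in> pverts G" for v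
      using eqs fD[of v] that by (cases "v \<in> {a, b, c}") auto
    with f(2) show False by blast
  qed
qed

end

end

section \<open>Isomorphisms and the concrete joins\<close>

text \<open>A digraph isomorphism carries separate maps for vertices, arcs, tails and heads. With
  \<open>fst\<close> and \<open>snd\<close> as projections, the vertex map determines the
  others.\<close>

lemma digraph_iso_with_proj:
  assumes G: "pair_wf_digraph G" and H: "pair_wf_digraph H"
  shows "digraph_iso (with_proj G) (with_proj H) \<longleftrightarrow>
    (\<exists>h. bij_betw h (pverts G) (pverts H) \<and>
      (\<forall>u\<in>pverts G. \<forall>v\<in>pverts G. (u, v) \<in> parcs G \<longleftrightarrow> (h u, h v) \<in> parcs H))"
    (is "?L \<longleftrightarrow> ?R")
proof
  interpret G: pair_wf_digraph G by fact
  assume ?L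
  then obtain f where f: "G.digraph_isomorphism f" and eq: "with_proj H = app_iso f (with_proj G)"
    unfolding digraph_iso_def by auto
  let ?h = "iso_verts f"
  have inj: "inj_on ?h (pverts G)"
    and arc: "\<And>a. a \<in> parcs G \<Longrightarrow> iso_tail f (iso_arcs f a) = ?h (fst a) \<and> iso_head f (iso_arcs f a) = ?h (snd a)"
    using f by (auto simp: G.digraph_isomorphism_def)
  \<comment> \<open>Comparing the fields of both sides shows that tail and head maps are the pair
    projections.\<close>
  have V: "pverts H = ?h ` pverts G" and A: "parcs H = iso_arcs f ` parcs G"
    and proj: "iso_tail f = fst" "iso_head f = snd"
    using arg_cong[OF eq, of verts] arg_cong[OF eq, of arcs] arg_cong[OF eq, of tail]
      arg_cong[OF eq, of head] by simp_all
  have img: "iso_arcs f a = (?h (fst a), ?h (snd a))" if "a \<in> parcs G" for a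
    using arc[OF that] proj by (simp add: prod_eq_iff)
  have "(u, v) \<in> parcs G \<longleftrightarrow> (?h u, ?h v) \<in> parcs H" if "u \<in> pverts G" "v \<in> pverts G" for u v
  proof
    assume "(u, v) \<in> parcs G"
    then show "(?h u, ?h v) \<in> parcs H" using A img[of "(u, v)"] by force
  next
    assume "(?h u, ?h v) \<in> parcs H"
    then obtain x y where xy: "(x, y) \<in> parcs G" "(?h u, ?h v) = (?h x, ?h y)"
      using A img by auto
    then show "(u, v) \<in> parcs G"
      using inj that G.in_arcsD1[OF xy(1)] G.in_arcsD2[OF xy(1)] by (auto dest: inj_onD)
  qed
  with inj V show ?R by (auto simp: bij_betw_def)
next
  interpret G: pair_wf_digraph G by fact
  interpret H: pair_wf_digraph H by fact
  assume ?R
  then obtain h where h: "inj_on h (pverts G)" "h ` pverts G = pverts H"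
    and arc: "\<And>u v. u \<in> pverts G \<Longrightarrow> v \<in> pverts G \<Longrightarrow> (u, v) \<in> parcs G \<longleftrightarrow> (h u, h v) \<in> parcs H"
    by (auto simp: bij_betw_def)
  let ?f = "\<lparr> iso_verts = h, iso_arcs = map_prod h h, iso_head = snd, iso_tail = fst \<rparr>"
  have "G.digraph_isomorphism ?f"
    unfolding G.digraph_isomorphism_def
  proof (intro conjI)
    show "wf_digraph (with_proj G)" by unfold_locales
    have "parcs G \<subseteq> pverts G \<times> pverts G" using G.in_arcsD1 G.in_arcsD2 by auto
    then show "inj_on (iso_arcs ?f) (parcs G)"
      using map_prod_inj_on[OF h(1) h(1)] by (auto intro: inj_on_subset)
  qed (use h in auto)
  moreover have "with_proj H = app_iso ?f (with_proj G)"
  proof -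
    have "parcs H = map_prod h h ` parcs G"
    proof (intro equalityI subsetI)
      fix e assume e: "e \<in> parcs H"
      then obtain u v where uv: "u \<in> pverts G" "v \<in> pverts G" "e = (h u, h v)"
        using H.in_arcsD1 H.in_arcsD2 h(2) by (cases e) (metis imageE)
      then have "(u, v) \<in> parcs G" using arc e by blast
      with uv show "e \<in> map_prod h h ` parcs G" by force
    next
      fix e assume "e \<in> map_prod h h ` parcs G"
      then obtain u v where "(u, v) \<in> parcs G" "e = (h u, h v)" by auto
      then show "e \<in> parcs H" using arc G.in_arcsD1 G.in_arcsD2 by metis
    qed
    then show ?thesis using h(2) by (simp add: with_proj_def app_iso_def)
  qed
  ultimately show ?L unfolding digraph_iso_def by blast
qed

lemma co_triple_arc_ends:
  assumes "co_triple q G a b c" and e: "(u, v) \<in> parcs G"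
  shows "u \<in> pverts G \<and> v \<in> pverts G"
  using e assms(1)[unfolded co_triple_def, THEN conjunct2, THEN conjunct2] by simp

lemma co_triple_wf:
  assumes "co_triple q G a b c"
  shows "pair_wf_digraph G"
proof (rule pair_wf_digraph.intro)
  fix e assume "e \<in> parcs G"
  then show "fst e \<in> pverts G" "snd e \<in> pverts G"
    using co_triple_arc_ends[OF assms, of "fst e" "snd e"] by simp_all
qed

text \<open>The triple is pulled back along the vertex bijection.\<close>

lemma co_triple_iso_image:
  assumes iso: "digraph_iso (with_proj G) (with_proj H)" and G: "pair_wf_digraph G"
    and H: "co_triple q H a b c"
  shows "\<exists>a b c. co_triple q G a b c"
proof -
  interpret G: pair_wf_digraph G by fact
  obtain h where h: "bij_betw h (pverts G) (pverts H)"
    and arc: "\<And>u v. u \<in> pverts G \<Longrightarrow> v \<in> pverts G \<Longrightarrow> (u, v) \<in> parcs G \<longleftrightarrow> (h u, h v) \<in> parcs H"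
    using iso digraph_iso_with_proj[OF G co_triple_wf[OF H]] by blast
  have eq: "h u = h v \<longleftrightarrow> u = v" if "u \<in> pverts G" "v \<in> pverts G" for u v
    using h that by (auto simp: bij_betw_def dest: inj_onD)
  have mem: "h u \<in> pverts H" if "u \<in> pverts G" for u using h that by (auto simp: bij_betw_def)
  have "a \<in> h ` pverts G" "b \<in> h ` pverts G" "c \<in> h ` pverts G"
    using H h by (auto simp: co_triple_def bij_betw_def)
  then obtain x y z where xyz: "x \<in> pverts G" "y \<in> pverts G" "z \<in> pverts G"
    "a = h x" "b = h y" "c = h z" by blast
  have dist: "distinct [x, y, z]" using H xyz by (auto simp: co_triple_def)
  have "(u, v) \<in> parcs G \<longleftrightarrow> u \<in> pverts G \<and> v \<in> pverts G \<and> u \<noteq> v \<and>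
       (u \<in> {x, y, z} \<and> v \<in> {x, y, z} \<longrightarrow> q \<and> {u, v} = {x, y})" for u v
  proof (cases "u \<in> pverts G \<and> v \<in> pverts G")
    case True
    then have "(u, v) \<in> parcs G \<longleftrightarrow> h u \<noteq> h v \<and> (h u \<in> {a, b, c} \<and> h v \<in> {a, b, c} \<longrightarrow> q \<and> {h u, h v} = {a, b})"
      using arc[of u v] mem[of u] mem[of v] H unfolding co_triple_def by simp
    then show ?thesis
      using True xyz eq by (simp add: doubleton_eq_iff)
  qed (use G.in_arcsD1 G.in_arcsD2 in blast)
  then have "parcs G = {(u, v). u \<in> pverts G \<and> v \<in> pverts G \<and> u \<noteq> v \<and>
       (u \<in> {x, y, z} \<and> v \<in> {x, y, z} \<longrightarrow> q \<and> {u, v} = {x, y})}" by auto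
  then have "co_triple q G x y z" using xyz dist by (simp add: co_triple_def)
  then show ?thesis by blast
qed

text \<open>Adjacency depends only on \<open>q\<close> and the position relative to the triple, so
  any bijection that matches the ordered triples preserves arcs.\<close>

lemma co_triple_iso:
  assumes G: "co_triple q G a b c" and H: "co_triple q H a' b' c'"
    and fin: "finite (pverts G)" "finite (pverts H)" and card: "card (pverts G) = card (pverts H)"
  shows "digraph_iso (with_proj G) (with_proj H)"
proof -
  have Gd: "a \<in> pverts G" "b \<in> pverts G" "c \<in> pverts G" "a \<noteq> b" "a \<noteq> c" "b \<noteq> c"
    using G by (auto simp: co_triple_def)
  have Hd: "a' \<in> pverts H" "b' \<in> pverts H" "c' \<in> pverts H" "a' \<noteq> b'" "a' \<noteq> c'" "b' \<noteq> c'"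
    using H by (auto simp: co_triple_def)
  have same: "card (pverts G - {a, b, c}) = card (pverts H - {a', b', c'})"
    using Gd Hd fin card by (simp add: card_Diff_subset)
  \<comment> \<open>Outside the triples an arbitrary bijection suffices, since equally many vertices
    remain.\<close>
  obtain h0 where h0: "bij_betw h0 (pverts G - {a, b, c}) (pverts H - {a', b', c'})"
    using finite_same_card_bij[OF _ _ same] fin by auto
  define h where "h = h0(a := a', b := b', c := c')"
  have "bij_betw h (pverts G - {a, b, c}) (pverts H - {a', b', c'})"
    using h0 bij_betw_cong[of "pverts G - {a, b, c}" h h0] by (auto simp: h_def)
  moreover have "bij_betw h {a, b, c} {a', b', c'}"
    using Gd Hd by (auto simp: bij_betw_def inj_on_def h_def)
  ultimately have "bij_betw h ((pverts G - {a, b, c}) \<union> {a, b, c}) ((pverts H - {a', b', c'}) \<union> {a', b', c'})"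
    by (rule bij_betw_combine) auto
  moreover have "(pverts G - {a, b, c}) \<union> {a, b, c} = pverts G"
    "(pverts H - {a', b', c'}) \<union> {a', b', c'} = pverts H"
    using Gd Hd by auto
  ultimately have bij: "bij_betw h (pverts G) (pverts H)" by simp
  have eq: "h u = h v \<longleftrightarrow> u = v" if "u \<in> pverts G" "v \<in> pverts G" for u v
    using bij that by (auto simp: bij_betw_def dest: inj_onD)
  have mem: "h u \<in> pverts H" if "u \<in> pverts G" for u using bij that by (auto simp: bij_betw_def)
  have img: "h a = a'" "h b = b'" "h c = c'" using Gd by (auto simp: h_def)
  have "(u, v) \<in> parcs G \<longleftrightarrow> (h u, h v) \<in> parcs H" if uv: "u \<in> pverts G" "v \<in> pverts G" for u v
  proof -
    have abc: "h w = a' \<longleftrightarrow> w = a" "h w = b' \<longleftrightarrow> w = b" "h w = c' \<longleftrightarrow> w = c" if "w \<in> pverts G" for w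
      using eq[OF that] Gd img by metis+
    show ?thesis
      using G H uv mem eq abc[OF uv(1)] abc[OF uv(2)] unfolding co_triple_def
      by (simp add: doubleton_eq_iff)
  qed
  then show ?thesis
    using digraph_iso_with_proj[OF co_triple_wf[OF G] co_triple_wf[OF H]] bij by blast
qed

lemma co_triple_join_two_one:
  "co_triple True (graph_join (complete_graph m) (disjoint_union (complete_graph 2) (complete_graph 1)))
     (Inr (Inl 0)) (Inr (Inl 1)) (Inr (Inr 0))"
proof -
  have two: "x < 2 \<longleftrightarrow> x = 0 \<or> x = Suc 0" for x :: nat by auto
  show ?thesis
    unfolding co_triple_def graph_join_def disjoint_union_def complete_graph_def
    by (auto simp: two image_iff doubleton_eq_iff lessThan_Suc split: sum.splits)
qed

lemma co_triple_join_edgeless: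
  "co_triple False (graph_join (complete_graph m) (edgeless_graph 3)) (Inr 0) (Inr 1) (Inr 2)"
proof -
  have three: "x < 3 \<longleftrightarrow> x = 0 \<or> x = Suc 0 \<or> x = 2" for x :: nat by auto
  show ?thesis
    unfolding co_triple_def graph_join_def disjoint_union_def complete_graph_def edgeless_graph_def
    by (auto simp: three image_iff doubleton_eq_iff split: sum.splits)
qed

lemma verts_join_two_one:
  "finite (pverts (graph_join (complete_graph m) (disjoint_union (complete_graph 2) (complete_graph 1))))"
  "card (pverts (graph_join (complete_graph m) (disjoint_union (complete_graph 2) (complete_graph 1)))) = m + 3"
  by (simp_all add: graph_join_def disjoint_union_def complete_graph_def card_Plus)

lemma verts_join_edgeless:
  "finite (pverts (graph_join (complete_graph m) (edgeless_graph 3)))"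
  "card (pverts (graph_join (complete_graph m) (edgeless_graph 3))) = m + 3"
  by (simp_all add: graph_join_def edgeless_graph_def complete_graph_def card_Plus)

section \<open>Characterisation and determination by the spectrum\<close>

lemma enumerated_connected_graph_exists:
  assumes "pair_graph G" "Digraph_Component.connected (with_proj G)"
  obtains vs where "enumerated_connected_graph G vs"
proof -
  interpret pair_graph G by fact
  obtain vs where "set vs = pverts G" "distinct vs"
    using finite_distinct_list[OF pair_finite_verts] by blast
  then have "enumerated_connected_graph G vs"
    using assms(2) by unfold_locales
  with that show thesis by blast
qed

lemma co_triple_free_vertex:
  assumes "4 \<le> card (pverts G)"
  obtains k where "k \<in> pverts G - {a, b, c}"
proof -
  have "card {a, b, c} \<le> 3" by (intro card_insert_le_m1) auto
  then have "\<not> pverts G \<subseteq> {a, b, c}"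
    using assms card_mono[of "{a, b, c}" "pverts G"] by auto
  with that show thesis by blast
qed

lemma size_ecc_spectrum_connected:
  assumes "pair_graph G" "Digraph_Component.connected (with_proj G)"
  shows "size (ecc_spectrum G) = card (pverts G)"
proof -
  obtain vs where "enumerated_connected_graph G vs"
    using enumerated_connected_graph_exists[OF assms] .
  then show ?thesis by (rule enumerated_connected_graph.size_ecc_spectrum)
qed

lemma count_minus_one_iff_co_triple:
  assumes "pair_graph G" "Digraph_Component.connected (with_proj G)" "9 \<le> card (pverts G)"
  shows "count (ecc_spectrum G) (-1) = card (pverts G) - 4 \<longleftrightarrow> (\<exists>q a b c. co_triple q G a b c)"
proof -
  obtain vs where "enumerated_connected_graph G vs"
    using enumerated_connected_graph_exists[OF assms(1,2)] .
  then interpret enumerated_connected_graph G vs .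
  \<comment> \<open>The subtraction on naturals is not truncated, as the order is at least
    9.\<close>
  have "count (ecc_spectrum G) (-1) = card (pverts G) - 4 \<longleftrightarrow> mult (-1) + 4 = card (pverts G)"
    using count_ecc_spectrum[of "-1"] assms(3) by auto
  also have "\<dots> \<longleftrightarrow> (\<exists>q a b c. co_triple q G a b c)"
  proof
    assume "\<exists>q a b c. co_triple q G a b c"
    then obtain q a b c where co: "co_triple q G a b c" by blast
    have n: "4 \<le> card (pverts G)" using assms(3) by simp
    obtain k where "k \<in> pverts G - {a, b, c}"
      using co_triple_free_vertex[OF n] .
    then show "mult (-1) + 4 = card (pverts G)"
      using co_triple_mult[OF co _ n] by blast
  qed (rule co_triple_if_mult[OF _ assms(3)])
  finally show ?thesis .
qed

text \<open>This separates the two graphs, which share the multiplicity of -1.\<close>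

lemma zero_in_ecc_spectrum_iff:
  assumes "pair_graph G" "Digraph_Component.connected (with_proj G)" "9 \<le> card (pverts G)"
    and co: "co_triple q G a b c"
  shows "0 \<in># ecc_spectrum G \<longleftrightarrow> q"
proof -
  obtain vs where "enumerated_connected_graph G vs"
    using enumerated_connected_graph_exists[OF assms(1,2)] .
  then interpret enumerated_connected_graph G vs .
  have n: "4 \<le> card (pverts G)" using assms(3) by simp
  obtain k where k: "k \<in> pverts G - {a, b, c}"
    using co_triple_free_vertex[OF n] .
  have "0 \<in># ecc_spectrum G \<longleftrightarrow> 0 < mult 0"
    using count_ecc_spectrum[of 0] by (simp flip: count_greater_zero_iff)
  also have "\<dots> \<longleftrightarrow> q"
    using co_triple_zero_eigenvalue[OF co k n] assms(3) by simp
  finally show ?thesis .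
qed

text \<open>The spectrum yields in turn the order (its size), the presence of a triple (multiplicity
  of -1) and the value of \<open>q\<close> (eigenvalue 0); these fix the graph up to
  isomorphism.\<close>

lemma co_triple_determined_by_ecc_spectrum:
  assumes G: "pair_graph G" "Digraph_Component.connected (with_proj G)" "9 \<le> card (pverts G)"
    and co: "co_triple q G a b c"
  shows "determined_by_ecc_spectrum TYPE('b) G"
  unfolding determined_by_ecc_spectrum_def
proof (intro allI impI, elim conjE)
  fix H :: "'b pair_pre_digraph"
  assume H: "pair_graph H" "Digraph_Component.connected (with_proj H)"
    and spec: "ecc_spectrum H = ecc_spectrum G"
  have card: "card (pverts H) = card (pverts G)"
    using size_ecc_spectrum_connected[OF H] size_ecc_spectrum_connected[OF G(1,2)] spec by simp
  have "9 \<le> card (pverts H)" using card G(3) by simp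
  note H = H this
  have "count (ecc_spectrum G) (-1) = card (pverts G) - 4"
    using count_minus_one_iff_co_triple[OF G] co by blast
  then have "count (ecc_spectrum H) (-1) = card (pverts H) - 4"
    using card spec by simp
  then obtain q' a' b' c' where co': "co_triple q' H a' b' c'"
    using count_minus_one_iff_co_triple[OF H] by blast
  have "q' = q"
    using zero_in_ecc_spectrum_iff[OF G co] zero_in_ecc_spectrum_iff[OF H co'] spec by simp
  then have "co_triple q H a' b' c'" using co' by simp
  moreover have fin: "finite (pverts H)" "finite (pverts G)"
    using G(3) H(3) by (auto intro: card_ge_0_finite)
  ultimately show "digraph_iso (with_proj H) (with_proj G)"
    by (intro co_triple_iso[OF _ co _ _ card])
qed

lemma digraph_iso_co_triple_iff:
  assumes G: "pair_wf_digraph G" "finite (pverts G)"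
    and H: "co_triple q H a b c" "finite (pverts H)" "card (pverts G) = card (pverts H)"
  shows "digraph_iso (with_proj G) (with_proj H) \<longleftrightarrow> (\<exists>x y z. co_triple q G x y z)"
  using co_triple_iso_image[OF _ G(1) H(1)] co_triple_iso[OF _ H(1) G(2) H(2,3)] by blast

theorem theorem3p4:
  fixes G :: "'a pair_pre_digraph" and n :: nat
  assumes "pair_graph G"
    and "Digraph_Component.connected (with_proj G)"
    and "card (pverts G) = n"
    and "n \<ge> 9"
  shows "(count (ecc_spectrum G) (-1) = n - 4 \<longleftrightarrow>
            digraph_iso (with_proj G) (with_proj (graph_join (complete_graph (n - 3))
              (disjoint_union (complete_graph 2) (complete_graph 1)))) \<or>
            digraph_iso (with_proj G) (with_proj (graph_join (complete_graph (n - 3))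
              (edgeless_graph 3)))) \<and>
         (digraph_iso (with_proj G) (with_proj (graph_join (complete_graph (n - 3))
              (disjoint_union (complete_graph 2) (complete_graph 1)))) \<or>
            digraph_iso (with_proj G) (with_proj (graph_join (complete_graph (n - 3))
              (edgeless_graph 3))) \<longrightarrow>
          determined_by_ecc_spectrum TYPE('b) G)"
proof -
  interpret pair_graph G by fact
  have card: "9 \<le> card (pverts G)" "card (pverts G) = n - 3 + 3" using assms(3,4) by auto
  have wf: "pair_wf_digraph G" by unfold_locales
  let ?H = "graph_join (complete_graph (n - 3)) (disjoint_union (complete_graph 2) (complete_graph 1))"
  let ?H' = "graph_join (complete_graph (n - 3)) (edgeless_graph 3)"
  have iso: "digraph_iso (with_proj G) (with_proj ?H) \<longleftrightarrow> (\<exists>a b c. co_triple True G a b c)"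
    by (rule digraph_iso_co_triple_iff[OF wf pair_finite_verts co_triple_join_two_one verts_join_two_one(1)])
      (simp only: card(2) verts_join_two_one(2))
  have iso': "digraph_iso (with_proj G) (with_proj ?H') \<longleftrightarrow> (\<exists>a b c. co_triple False G a b c)"
    by (rule digraph_iso_co_triple_iff[OF wf pair_finite_verts co_triple_join_edgeless verts_join_edgeless(1)])
      (simp only: card(2) verts_join_edgeless(2))
  \<comment> \<open>The two values of the Boolean \<open>q\<close> correspond to the two
    joins.\<close>
  have "(\<exists>q a b c. co_triple q G a b c) \<longleftrightarrow>
      (\<exists>a b c. co_triple True G a b c) \<or> (\<exists>a b c. co_triple False G a b c)"
    by (metis (full_types))
  then show ?thesis
    unfolding iso iso'
    using count_minus_one_iff_co_triple[OF assms(1,2) card(1)] assms(3)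
      co_triple_determined_by_ecc_spectrum[OF assms(1,2) card(1)]
    by blast
qed

end
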